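(* Let $G$ be a connected graph on $n$ vertices with $e$ edges and diameter $d$, where $n\ge 5$ and $d\ge 2$. If $k$ is an integer with $$\binom{\binom{k}{2}+d-1}{d-1} < n-2k+2,$$ then $h(G)\ge \max\{k,\ d/2,\ \sqrt{2e/n}\}$. In particular, if $n\ge d^{2d-2}$, then $$h(G)\ge \max\{0.5\,n^{1/(2d-2)},\ d/2,\ \sqrt{2e/n}\}.$$
   Context: $d_G(u,v)$ denotes the shortest-path distance in $G$. For $S\subseteq V(G)$, the distance multiset $D(S)$ is the multiset of distances $d_G(u,v)$ over all unordered pairs of distinct vertices $u,v\in S$. Two vertex sets $S_1,S_2$ are homometric if $D(S_1)=D(S_2)$. $h(G)$ is the largest integer $h$ such that $G$ contains two disjoint homometric sets $S_1,S_2$ with $|S_1|=|S_2|=h$. *)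

theory Defs
  imports Complex_Main "HOL-Library.Multiset" "Graph_Theory.Graph_Theory"
begin

(* Finite simple graphs are pair_graph: finite, loop-free, symmetric digraphs
   whose arcs are ordered pairs; an edge uv is the pair of arcs (u,v), (v,u). *)

definition edge_set :: "'a pair_pre_digraph \<Rightarrow> 'a set set" where
  "edge_set G = (\<lambda>(u, v). {u, v}) ` parcs G"

(* wf_digraph.\<mu> is the library's weighted shortest-path distance, \<infinity> if v is
   unreachable from u; with unit weights the cost of a walk is its length. *)
definition graph_dist :: "'a pair_pre_digraph \<Rightarrow> 'a \<Rightarrow> 'a \<Rightarrow> ereal" where
  "graph_dist G u v = wf_digraph.\<mu> (with_proj G) (\<lambda>_. 1) u v"

definition graph_diameter :: "'a pair_pre_digraph \<Rightarrow> ereal" where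
  "graph_diameter G = (SUP (u, v) \<in> pverts G \<times> pverts G. graph_dist G u v)"

(* Distance of an unordered pair {u, v}; well defined because graph_dist is
   symmetric, see pair_dist_doubleton. *)
definition pair_dist :: "'a pair_pre_digraph \<Rightarrow> 'a set \<Rightarrow> ereal" where
  "pair_dist G P = (THE x. \<exists>u v. P = {u, v} \<and> u \<noteq> v \<and> x = graph_dist G u v)"

definition distance_mset :: "'a pair_pre_digraph \<Rightarrow> 'a set \<Rightarrow> ereal multiset" where
  "distance_mset G S = image_mset (pair_dist G) (mset_set {P. P \<subseteq> S \<and> card P = 2})"

definition homometric :: "'a pair_pre_digraph \<Rightarrow> 'a set \<Rightarrow> 'a set \<Rightarrow> bool" where
  "homometric G S T \<longleftrightarrow>
     S \<subseteq> pverts G \<and> T \<subseteq> pverts G \<and> distance_mset G S = distance_mset G T"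

definition homometric_number :: "'a pair_pre_digraph \<Rightarrow> nat" where
  "homometric_number G =
     Max {h. \<exists>S T. homometric G S T \<and> S \<inter> T = {} \<and> card S = h \<and> card T = h}"

lemma (in pair_graph) awalk_reverse:
  "awalk u p v \<Longrightarrow> awalk v (rev (map prod.swap p)) u"
proof (induction p arbitrary: u)
  case Nil
  then show ?case by (auto simp: awalk_Nil_iff)
next
  case (Cons a p)
  have a: "a \<in> parcs G" "u = fst a" and p: "awalk (snd a) p v"
    using Cons.prems by (auto simp: awalk_Cons_iff)
  have "prod.swap a \<in> parcs G"
    using a pair_sym_arcs by (cases a) (auto simp: symmetric_def sym_def)
  then have "awalk (snd a) [prod.swap a] u"
    using a arc_fst_in_verts arc_snd_in_verts by (auto simp: awalk_Cons_iff awalk_Nil_iff)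
  with Cons.IH[OF p] show ?case
    by (auto intro: awalk_appendI)
qed

lemma (in pair_graph) awalk_cost_one: "awalk_cost (\<lambda>_. 1) p = real (length p)"
  by (induction p) auto

lemma (in pair_graph) graph_dist_conv:
  "graph_dist G u v = (INF p \<in> {p. awalk u p v}. ereal (length p))"
  unfolding graph_dist_def \<mu>_def by (simp add: awalk_cost_one)

lemma (in pair_graph) graph_dist_sym: "graph_dist G u v = graph_dist G v u"
proof -
  have "graph_dist G x y \<le> graph_dist G y x" for x y
    unfolding graph_dist_conv
    by (rule INF_mono) (use awalk_reverse in force)
  then show ?thesis by (blast intro: antisym)
qed

lemma (in pair_graph) pair_dist_doubleton:
  "u \<noteq> v \<Longrightarrow> pair_dist G {u, v} = graph_dist G u v"
  unfolding pair_dist_def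
  by (rule the_equality) (auto simp: doubleton_eq_iff graph_dist_sym)

end

theory Submission
  imports Defs
begin

text \<open>If the k-subsets of V are coloured by their distance multisets, a homometric pair is an edge of the
  Kneser graph with both ends of the same colour; there are at most binom(binom(k,2)+d-1, d-1) colours, so the
  first bound is the Lovasz--Kneser theorem. It is proved combinatorially: every antipodal sign function on the
  nonempty signed subsets of V alternates along some maximal chain.

  The bound d/2 comes from cutting a diametral path in two. For the square root, suppose the homometric
  number H satisfies 2e > H^2 n; then some vertex v has degree above H^2, and distances in its closed
  neighbourhood N[v] are at most 2, so only edge numbers matter there. For H at least 5 the Kneser bound
  in N[v] suffices. For H = 3, 4 it falls short of what is needed, but any 11 (18) vertices contain two disjoint
  4-sets (5-sets) with equally many edges: the zig-zag version of Kneser's theorem allows one to choose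
  the order of the colours. For H = 2, a graph with more than 2n edges has two disjoint triangles or
  two disjoint induced paths on three vertices.\<close>

subsection \<open>Alternating chains of signed sets\<close>

text \<open>The hypothesis of the first claim says that there are fewer colours than n - 2k + 2, the
  chromatic number of the Kneser graph of the k-subsets of an n-set. The square root leaves little
  room: from 2e > H^2 n one only gets a closed neighbourhood N[v] with at least H^2 + 2 vertices, in
  which k-subsets have at most binom(k,2) + 1 colours, and k = H + 1 is required. Kneser's theorem
  applies there if H(H+1)/2 + 2H < H^2 + 1; for H at least 2 this means H >= 5. For H = 3 and H = 4
  it would need 14 and 20 vertices, against 11 and 18 in N[v]. This gap is why the order of the
  colours is kept, and not only their number. For H = 2 no argument inside N[v] alone can succeed:
  in the star with five leaves a triple spans two edges if it contains the centre and none
  otherwise, so no two disjoint triples agree. Hence that case counts all edges of the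
  graph.\<close>

lemma even_card_involution:
  assumes "finite A" and "\<And>x. x \<in> A \<Longrightarrow> f x \<in> A \<and> f (f x) = x \<and> f x \<noteq> x"
  shows "even (card A)"
  using assms
proof (induction "card A" arbitrary: A rule: less_induct)
  case less
  show ?case
  proof (cases "A = {}")
    case False
    then obtain x where x: "x \<in> A" by blast
    let ?B = "A - {x, f x}"
    have fx: "f x \<in> A" "f (f x) = x" "f x \<noteq> x" using less.prems(2)[OF x] by auto
    have card: "card A = card ?B + 2"
    proof -
      have "card {x, f x} = 2" using fx by auto
      moreover have "card ?B = card A - card {x, f x}"
        using x fx less.prems(1) by (intro card_Diff_subset) auto
      moreover have "card {x, f x} \<le> card A"
        using x fx less.prems(1) by (intro card_mono) auto
      ultimately show ?thesis by linarith
    qed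
    have "f y \<in> ?B \<and> f (f y) = y \<and> f y \<noteq> y" if "y \<in> ?B" for y
    proof -
      have y: "f y \<in> A" "f (f y) = y" "f y \<noteq> y" using less.prems(2)[of y] that by auto
      have "f y \<noteq> x" "f y \<noteq> f x" using that y fx by auto
      with y show ?thesis by blast
    qed
    then have "even (card ?B)"
      by (intro less.hyps) (use card less.prems(1) in simp_all)
    then show ?thesis using card by simp
  qed simp
qed

primrec alternating :: "bool \<Rightarrow> bool list \<Rightarrow> bool" where
  "alternating b [] \<longleftrightarrow> True"
| "alternating b (x # xs) \<longleftrightarrow> x = b \<and> alternating (\<not> b) xs"

definition delete_nth :: "nat \<Rightarrow> 'a list \<Rightarrow> 'a list" where
  "delete_nth i xs = take i xs @ drop (Suc i) xs"

lemma delete_nth_Cons_0 [simp]: "delete_nth 0 (x # xs) = xs"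
  and delete_nth_Cons_Suc [simp]: "delete_nth (Suc i) (x # xs) = x # delete_nth i xs"
  by (simp_all add: delete_nth_def)

lemma alternating_nth: "alternating b xs \<Longrightarrow> i < length xs \<Longrightarrow> xs ! i = (b = even i)"
proof (induction xs arbitrary: b i)
  case (Cons x xs)
  then show ?case by (cases i) auto
qed simp

lemma alternating_map_Not: "alternating b (map Not xs) = alternating (\<not> b) xs"
  by (induction xs arbitrary: b) auto

text \<open>A nonempty alternating word has exactly one deletion that leaves an alternating word
  starting with \<open>b\<close>, at its last or first position according to its own first sign. A
  word that does not alternate has none or two, the two members of its only repeated neighbouring
  pair. The empty word is counted by both indicators.\<close>

lemma even_card_alternating_deletions:
  "even (card {i. i < length xs \<and> alternating b (delete_nth i xs)}
     + of_bool (alternating True xs) + of_bool (alternating False xs))"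
proof (induction xs arbitrary: b)
  case (Cons x xs)
  let ?D = "\<lambda>b. {i. i < length xs \<and> alternating b (delete_nth i xs)}"
  let ?L = "{i. i < length (x # xs) \<and> alternating b (delete_nth i (x # xs))}"
  let ?R = "(if alternating b xs then {0} else {}) \<union> (if x = b then Suc ` ?D (\<not> b) else {})"
  have "?L = ?R"
  proof (rule set_eqI)
    show "i \<in> ?L \<longleftrightarrow> i \<in> ?R" for i by (cases i) auto
  qed
  moreover have "card ?R = of_bool (alternating b xs) + (if x = b then card (?D (\<not> b)) else 0)"
    by (subst card_Un_disjoint) (auto simp: card_image)
  ultimately have L: "card ?L = of_bool (alternating b xs) + (if x = b then card (?D (\<not> b)) else 0)"
    by (rule trans[OF arg_cong[where f = card]])
  have IH: "even (card (?D (\<not> b)) + of_bool (alternating b xs) + of_bool (alternating (\<not> b) xs))"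
    using Cons.IH[of "\<not> b"] by (cases b) (simp_all add: ac_simps)
  show ?case
    unfolding L using IH by (cases b; cases x) (simp_all add: ac_simps)
qed simp

text \<open>A signed subset of V is a set of pairs (element, sign); a maximal chain of nonempty signed
  sets is given by the list of pairs in the order in which they are added.\<close>

definition signed_orders :: "'a set \<Rightarrow> ('a \<times> bool) list set" where
  "signed_orders V = {xs. distinct (map fst xs) \<and> set (map fst xs) = V}"

definition flip_sign :: "'a \<times> bool \<Rightarrow> 'a \<times> bool" where
  "flip_sign x = (fst x, \<not> snd x)"

lemma flip_sign_simps [simp]: "fst (flip_sign x) = fst x" "snd (flip_sign x) = (\<not> snd x)"
    "flip_sign (flip_sign x) = x" "flip_sign x \<noteq> x"
  by (cases x; simp add: flip_sign_def)+

definition chain_signs :: "(('a \<times> bool) set \<Rightarrow> bool) \<Rightarrow> ('a \<times> bool) list \<Rightarrow> bool list" where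
  "chain_signs s xs = map (\<lambda>j. s (set (take (Suc j) xs))) [0..<length xs]"

lemma length_chain_signs [simp]: "length (chain_signs s xs) = length xs"
  by (simp add: chain_signs_def)

lemma chain_signs_nth: "j < length xs \<Longrightarrow> chain_signs s xs ! j = s (set (take (Suc j) xs))"
  by (simp add: chain_signs_def)

lemma length_signed_orders: "xs \<in> signed_orders V \<Longrightarrow> length xs = card V"
  by (metis (mono_tags, lifting) signed_orders_def distinct_card length_map mem_Collect_eq)

lemma finite_signed_orders: "finite V \<Longrightarrow> finite (signed_orders V)"
proof -
  assume V: "finite V"
  have "signed_orders V \<subseteq> {xs. set xs \<subseteq> V \<times> UNIV \<and> length xs = card V}"
  proof
    fix xs assume xs: "xs \<in> signed_orders V"
    then have "set xs \<subseteq> V \<times> UNIV" by (force simp: signed_orders_def)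
    with xs show "xs \<in> {xs. set xs \<subseteq> V \<times> UNIV \<and> length xs = card V}"
      by (simp add: length_signed_orders)
  qed
  then show ?thesis
    by (rule finite_subset) (use V in \<open>auto intro: finite_lists_length_eq\<close>)
qed

lemma chain_signs_snoc: "chain_signs s (xs @ [x]) = chain_signs s xs @ [s (insert x (set xs))]"
  by (simp add: chain_signs_def)

text \<open>Exchanging the entries \<open>i\<close> and \<open>i + 1\<close> of an order replaces
  only the chain member with \<open>i + 1\<close> elements: two signed sets whose sizes differ by 2
  have exactly two signed sets between them.\<close>

definition swap_next :: "nat \<Rightarrow> 'a list \<Rightarrow> 'a list" where
  "swap_next i xs = xs[i := xs ! Suc i, Suc i := xs ! i]"

lemma swap_next_mset: "Suc i < length xs \<Longrightarrow> mset (swap_next i xs) = mset xs"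
  by (simp add: swap_next_def mset_swap)

lemma swap_next:
  assumes "Suc i < length xs"
  shows "swap_next i (swap_next i xs) = xs"
    "length (swap_next i xs) = length xs"
    "j \<noteq> i \<Longrightarrow> set (take (Suc j) (swap_next i xs)) = set (take (Suc j) xs)"
proof -
  show "swap_next i (swap_next i xs) = xs"
    using assms by (auto simp: swap_next_def intro!: nth_equalityI simp: nth_list_update)
  show "length (swap_next i xs) = length xs" by (simp add: swap_next_def)
  show "set (take (Suc j) (swap_next i xs)) = set (take (Suc j) xs)" if "j \<noteq> i"
  proof (cases "j < i")
    case True
    then show ?thesis by (simp add: swap_next_def)
  next
    case False
    with that have "Suc i < Suc j" by simp
    have "mset (take (Suc j) (swap_next i xs)) = mset (swap_next i (take (Suc j) xs))"
      using \<open>Suc i < Suc j\<close> assms by (simp add: swap_next_def take_update_swap)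
    also have "\<dots> = mset (take (Suc j) xs)"
      using \<open>Suc i < Suc j\<close> assms by (intro swap_next_mset) simp
    finally show ?thesis by (metis set_mset_mset)
  qed
qed

text \<open>The hypothesis \<open>anti\<close> ranges over lists with distinct first components
  because their sets are exactly the finite signed sets in which no element carries both
  signs.\<close>

lemma chain_signs_map_flip:
  assumes anti: "\<And>xs. xs \<noteq> [] \<Longrightarrow> distinct (map fst xs) \<Longrightarrow> s (flip_sign ` set xs) \<longleftrightarrow> \<not> s (set xs)"
    and "distinct (map fst xs)"
  shows "chain_signs s (map flip_sign xs) = map Not (chain_signs s xs)"
proof (rule nth_equalityI)
  fix j assume "j < length (chain_signs s (map flip_sign xs))"
  then have j: "j < length xs" by simp
  have "distinct (map fst (take (Suc j) xs))"
    using assms(2) by (simp add: take_map[symmetric])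
  then have "s (flip_sign ` set (take (Suc j) xs)) \<longleftrightarrow> \<not> s (set (take (Suc j) xs))"
    using j by (intro anti) auto
  then show "chain_signs s (map flip_sign xs) ! j = map Not (chain_signs s xs) ! j"
    using j by (simp add: chain_signs_nth take_map)
qed simp

lemma signed_orders_map_flip: "xs \<in> signed_orders V \<Longrightarrow> map flip_sign xs \<in> signed_orders V"
  by (simp add: signed_orders_def comp_def image_image)

lemma delete_nth_swap_chain_signs:
  assumes "Suc i < length xs"
  shows "delete_nth i (chain_signs s (swap_next i xs)) = delete_nth i (chain_signs s xs)"
proof (rule nth_equalityI)
  show len: "length (delete_nth i (chain_signs s (swap_next i xs))) = length (delete_nth i (chain_signs s xs))"
    using swap_next(2)[OF assms] by (simp add: delete_nth_def)
  fix j assume "j < length (delete_nth i (chain_signs s (swap_next i xs)))"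
  then have "j < length (delete_nth i (chain_signs s xs))" using len by simp
  then have j: "Suc j < length xs" using assms by (simp add: delete_nth_def)
  have "chain_signs s (swap_next i xs) ! m = chain_signs s xs ! m" if "m < length xs" "m \<noteq> i" for m
    using that swap_next(2)[OF assms] swap_next(3)[OF assms] by (simp add: chain_signs_nth)
  then show "delete_nth i (chain_signs s (swap_next i xs)) ! j = delete_nth i (chain_signs s xs) ! j"
    using j assms swap_next(2)[OF assms] by (simp add: delete_nth_def nth_append)
qed

lemma swap_next_signed_orders:
  assumes "Suc i < length xs" "xs \<in> signed_orders V"
  shows "swap_next i xs \<in> signed_orders V" "set (swap_next i xs) = set xs" "swap_next i xs \<noteq> xs"
proof -
  have m: "mset (swap_next i xs) = mset xs" by (rule swap_next_mset[OF assms(1)])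
  then show s: "set (swap_next i xs) = set xs" by (metis set_mset_mset)
  have "mset (map fst (swap_next i xs)) = mset (map fst xs)" using m by simp
  then have "distinct (map fst (swap_next i xs)) = distinct (map fst xs)"
    by (rule mset_eq_imp_distinct_iff)
  then show "swap_next i xs \<in> signed_orders V" using assms s by (simp add: signed_orders_def)
  have "swap_next i xs ! i = xs ! Suc i" using assms by (simp add: swap_next_def)
  moreover have "distinct xs" using assms by (simp add: signed_orders_def distinct_map)
  ultimately show "swap_next i xs \<noteq> xs" using assms by (auto simp: nth_eq_iff_index_eq)
qed

text \<open>The counterpart of \<open>swap_next\<close> for the top member of a maximal chain: the
  last element can only enter with the opposite sign.\<close>

definition flip_last :: "('a \<times> bool) list \<Rightarrow> ('a \<times> bool) list" where
  "flip_last xs = butlast xs @ [flip_sign (last xs)]"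

lemma flip_last:
  assumes "xs \<noteq> []"
  shows "flip_last (flip_last xs) = xs" "flip_last xs \<noteq> xs" "map fst (flip_last xs) = map fst xs"
    "delete_nth (length xs - 1) (chain_signs s (flip_last xs)) = delete_nth (length xs - 1) (chain_signs s xs)"
    "length (flip_last xs) = length xs"
proof -
  obtain ys y where xs: "xs = ys @ [y]" using assms by (metis rev_exhaust)
  show "flip_last (flip_last xs) = xs" "flip_last xs \<noteq> xs" "map fst (flip_last xs) = map fst xs"
    "length (flip_last xs) = length xs"
    by (simp_all add: xs flip_last_def)
  show "delete_nth (length xs - 1) (chain_signs s (flip_last xs)) = delete_nth (length xs - 1) (chain_signs s xs)"
    by (simp add: xs flip_last_def delete_nth_def chain_signs_snoc)
qed

text \<open>The parity argument behind Ky Fan's lemma, on the barycentric subdivision of the boundary of the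
  cross-polytope. Removing one member from a maximal chain of a closed hemisphere leaves a chain that
  has exactly two completions in the hemisphere, unless the top member is removed and the
  rest lies on the equator.\<close>

lemma odd_card_alternating_orders:
  assumes "finite V"
    and anti: "\<And>xs. xs \<noteq> [] \<Longrightarrow> distinct (map fst xs) \<Longrightarrow> s (flip_sign ` set xs) \<longleftrightarrow> \<not> s (set xs)"
  shows "odd (card {xs \<in> signed_orders V. alternating True (chain_signs s xs)})"
  using assms(1)
proof (induction V rule: finite_induct)
  case empty
  have "{xs \<in> signed_orders ({} :: 'a set). alternating True (chain_signs s xs)} = {[]}"
    by (auto simp: signed_orders_def chain_signs_def)
  then show ?case by simp
next
  case (insert a V)
  let ?n = "card V"
  let ?W = "insert a V"
  \<comment> \<open>The closed hemisphere with pole \<open>(a, True)\<close>: no set of such a chain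
    contains \<open>(a, False)\<close>.\<close>
  define H where "H = {xs \<in> signed_orders ?W. (a, True) \<in> set xs}"
  define alt where "alt b xs \<longleftrightarrow> alternating b (chain_signs s xs)" for b xs
  have finW: "finite (signed_orders ?W)" using insert by (intro finite_signed_orders) simp
  then have finH: "finite H" by (simp add: H_def)
  have lenH: "length xs = Suc ?n" if "xs \<in> H" for xs
    using that insert length_signed_orders[of xs ?W] by (simp add: H_def)
  have a_notin: "(a, False) \<notin> set xs" if "xs \<in> H" for xs
  proof
    assume "(a, False) \<in> set xs"
    moreover have "(a, True) \<in> set xs" "distinct (map fst xs)"
      using that by (auto simp: H_def signed_orders_def)
    ultimately show False using eq_key_imp_eq_value by fastforce
  qed
  \<comment> \<open>Negation carries the alternating chains outside the hemisphere to those inside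
    it that alternate with the opposite first sign.\<close>
  have total: "card {xs \<in> signed_orders ?W. alt True xs}
      = card {xs \<in> H. alt True xs} + card {xs \<in> H. alt False xs}"
  proof -
    let ?L = "{xs \<in> signed_orders ?W. xs \<notin> H \<and> alt True xs}"
    have memL: "(a, False) \<in> set xs" if "xs \<in> ?L" for xs
    proof -
      have "a \<in> fst ` set xs" using that by (auto simp: signed_orders_def)
      then obtain c where "(a, c) \<in> set xs" by auto
      then show ?thesis using that by (cases c) (auto simp: H_def)
    qed
    have "bij_betw (map flip_sign) ?L {xs \<in> H. alt False xs}"
    proof (rule bij_betw_byWitness[where f' = "map flip_sign"])
      show "map flip_sign ` ?L \<subseteq> {xs \<in> H. alt False xs}"
      proof safe
        fix xs assume xs: "xs \<in> signed_orders ?W" "xs \<notin> H" "alt True xs"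
        then have "(a, False) \<in> set xs" using memL by blast
        then have "(a, True) \<in> set (map flip_sign xs)" by (force simp: flip_sign_def)
        with xs show "map flip_sign xs \<in> H" by (simp add: H_def signed_orders_map_flip)
        show "alt False (map flip_sign xs)"
          using xs chain_signs_map_flip[of s xs] anti
          by (simp add: alt_def signed_orders_def alternating_map_Not)
      qed
      show "map flip_sign ` {xs \<in> H. alt False xs} \<subseteq> ?L"
      proof safe
        fix xs assume xs: "xs \<in> H" "alt False xs"
        then have o: "xs \<in> signed_orders ?W" by (simp add: H_def)
        then show "map flip_sign xs \<in> signed_orders ?W" by (rule signed_orders_map_flip)
        show "alt True (map flip_sign xs)"
          using xs o chain_signs_map_flip[of s xs] anti
          by (simp add: alt_def signed_orders_def alternating_map_Not)
        assume "map flip_sign xs \<in> H"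
        then have "(a, True) \<in> flip_sign ` set xs" by (simp add: H_def)
        then have "(a, False) \<in> set xs" by (auto simp: flip_sign_def)
        then show False using a_notin xs by blast
      qed
    qed (simp_all add: comp_def)
    then have "card ?L = card {xs \<in> H. alt False xs}" by (rule bij_betw_same_card)
    moreover have "{xs \<in> signed_orders ?W. alt True xs} = {xs \<in> H. alt True xs} \<union> ?L"
      by (auto simp: H_def)
    moreover have "card ({xs \<in> H. alt True xs} \<union> ?L) = card {xs \<in> H. alt True xs} + card ?L"
      using finW finH by (intro card_Un_disjoint) auto
    ultimately show ?thesis by simp
  qed
  \<comment> \<open>The incidences of the double count. Summed over the chains they have the parity
    of the alternating chains of \<open>H\<close>, with either first sign; paired by exchanging the
    removed member, only those in \<open>F\<close> remain.\<close>
  define T where "T = (SIGMA xs:H. {i. i < Suc ?n \<and> alternating True (delete_nth i (chain_signs s xs))})"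
  define F where "F = {(xs, i) \<in> T. i = ?n \<and> last xs = (a, True)}"
  have finT: "finite T" unfolding T_def using finH by (intro finite_SigmaI) auto
  have "even (card T + (card {xs \<in> H. alt True xs} + card {xs \<in> H. alt False xs}))"
  proof -
    have "card T = (\<Sum>xs\<in>H. card {i. i < Suc ?n \<and> alternating True (delete_nth i (chain_signs s xs))})"
      unfolding T_def using finH by (intro card_SigmaI) auto
    moreover have "card {xs \<in> H. alt b xs} = (\<Sum>xs\<in>H. of_bool (alt b xs))" for b
      using finH by (simp add: of_bool_def sum.If_cases Int_def)
    ultimately have "card T + (card {xs \<in> H. alt True xs} + card {xs \<in> H. alt False xs})
        = (\<Sum>xs\<in>H. card {i. i < Suc ?n \<and> alternating True (delete_nth i (chain_signs s xs))}
            + of_bool (alt True xs) + of_bool (alt False xs))"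
      by (simp add: sum.distrib)
    moreover have "even \<dots>"
    proof (rule dvd_sum)
      fix xs assume "xs \<in> H"
      then show "even (card {i. i < Suc ?n \<and> alternating True (delete_nth i (chain_signs s xs))}
            + of_bool (alt True xs) + of_bool (alt False xs))"
        using even_card_alternating_deletions[of "chain_signs s xs" True] lenH by (simp add: alt_def)
    qed
    ultimately show ?thesis by simp
  qed
  moreover have "even (card (T - F))"
  proof (rule even_card_involution)
    show "finite (T - F)" using finT by simp
    define f where "f = (\<lambda>(xs :: ('a \<times> bool) list, i). if i < ?n then (swap_next i xs, i) else (flip_last xs, i))"
    fix p assume p: "p \<in> T - F"
    obtain xs i where pi: "p = (xs, i)" by fastforce
    have xs: "xs \<in> H" "xs \<in> signed_orders ?W" "i \<le> ?n" "alternating True (delete_nth i (chain_signs s xs))"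
      using p by (auto simp: pi T_def H_def)
    have len: "length xs = Suc ?n" using lenH xs by simp
    show "f p \<in> T - F \<and> f (f p) = p \<and> f p \<noteq> p"
    proof (cases "i < ?n")
      case True
      then have i: "Suc i < length xs" using len by simp
      show ?thesis
        using True xs swap_next_signed_orders[OF i xs(2)] swap_next[OF i] delete_nth_swap_chain_signs[OF i, of s]
        by (auto simp: pi f_def T_def F_def H_def)
    next
      case False
      then have i: "i = ?n" using xs by simp
      have ne: "xs \<noteq> []" using len by auto
      have "last xs \<noteq> (a, True)" using p False i by (auto simp: pi F_def)
      moreover have "last xs \<noteq> (a, False)" using a_notin[OF xs(1)] ne by (metis last_in_set)
      ultimately have la: "fst (last xs) \<noteq> a" by (cases "last xs") auto
      have eq: "set xs = insert (last xs) (set (butlast xs))"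
        using ne by (metis append_butlast_last_id insert_is_Un list.simps(15) set_append sup_commute empty_set)
      have "(a, True) \<noteq> last xs" using la by (metis fst_conv)
      moreover have "(a, True) \<in> set xs" using xs(1) by (simp add: H_def)
      ultimately have "(a, True) \<in> set (butlast xs)" unfolding eq by blast
      then have "(a, True) \<in> set (flip_last xs)" by (simp add: flip_last_def)
      moreover have "flip_last xs \<in> signed_orders ?W"
        using xs(2) flip_last(3)[OF ne] by (metis (mono_tags, lifting) mem_Collect_eq signed_orders_def)
      moreover have "fst (last (flip_last xs)) \<noteq> a" using la by (simp add: flip_last_def)
      ultimately show ?thesis
        using False i xs flip_last[OF ne] flip_last(4)[OF ne, of s] len
        by (auto simp: pi f_def T_def F_def H_def)
    qed
  qed
  moreover have "card T = card (T - F) + card F"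
  proof -
    have "F \<subseteq> T" by (auto simp: F_def)
    then show ?thesis using finT card_Un_disjoint[of "T - F" F] by (auto simp: finite_subset Un_absorb2)
  qed
  \<comment> \<open>Dropping the final \<open>(a, True)\<close> identifies \<open>F\<close> with the
    alternating chains on the equator, whose number is odd by induction.\<close>
  moreover have "card F = card {xs \<in> signed_orders V. alt True xs}"
  proof -
    have eqF: "F = (\<lambda>ys. (ys @ [(a, True)], ?n)) ` {ys \<in> signed_orders V. alt True ys}" (is "_ = ?g ` ?S")
    proof (rule set_eqI)
      fix p show "p \<in> F \<longleftrightarrow> p \<in> ?g ` ?S"
      proof
        assume p: "p \<in> F"
        then obtain xs where xs: "p = (xs, ?n)" "xs \<in> H" "last xs = (a, True)"
          "alternating True (delete_nth ?n (chain_signs s xs))" by (auto simp: F_def T_def)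
        then have len: "length xs = Suc ?n" using lenH by blast
        then have "xs \<noteq> []" by auto
        then obtain ys where ys: "xs = ys @ [(a, True)]" using xs(3) by (metis append_butlast_last_id)
        have "ys \<in> signed_orders V"
          using xs(2) insert.hyps by (auto simp: ys H_def signed_orders_def)
        moreover have "alt True ys"
          using xs(4) len by (simp add: ys chain_signs_snoc delete_nth_def alt_def)
        ultimately show "p \<in> ?g ` ?S" using xs(1) ys by blast
      next
        assume "p \<in> ?g ` ?S"
        then obtain ys where ys: "p = (ys @ [(a, True)], ?n)" "ys \<in> signed_orders V" "alt True ys" by blast
        have "length ys = ?n" using ys length_signed_orders by blast
        then show "p \<in> F"
          using ys insert.hyps
          by (auto simp: F_def T_def H_def signed_orders_def alt_def chain_signs_snoc delete_nth_def)
      qed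
    qed
    show ?thesis unfolding eqF by (intro card_image) (auto intro: inj_onI)
  qed
  ultimately show ?case using insert.IH total by (simp add: alt_def)
qed

subsection \<open>The zig-zag theorem for Kneser colourings\<close>

text \<open>Every second one of the first \<open>j\<close> entries, counted back from entry
  \<open>j - 1\<close>. Thus \<open>side vs j\<close> and \<open>side vs (Suc j)\<close> split the
  first \<open>j + 1\<close> entries, and each step enlarges the older half.\<close>

definition side :: "'a list \<Rightarrow> nat \<Rightarrow> 'a set" where
  "side vs j = {vs ! i | i. i < j \<and> odd (i + j)}"

lemma side_Suc_Suc: "side vs (Suc (Suc j)) = insert (vs ! Suc j) (side vs j)"
  by (auto simp: side_def less_Suc_eq)

lemma side_0_1 [simp]: "side vs 0 = {}" "side vs (Suc 0) = {vs ! 0}"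
  by (auto simp: side_def)

lemma side_subset: "j \<le> length vs \<Longrightarrow> side vs j \<subseteq> set vs"
  by (auto simp: side_def)

lemma finite_side [simp]: "finite (side vs j)"
proof (rule finite_subset)
  show "side vs j \<subseteq> (\<lambda>i. vs ! i) ` {..<j}" by (auto simp: side_def)
qed simp

lemma card_side:
  assumes "distinct vs" "j \<le> length vs"
  shows "card (side vs j) = Suc j div 2"
  using assms(2)
proof (induction j rule: less_induct)
  case (less j)
  consider "j = 0" | "j = 1" | i where "j = Suc (Suc i)" by (metis One_nat_def not0_implies_Suc)
  then show ?case
  proof cases
    case 3
    have "vs ! Suc i \<notin> side vs i"
      using assms(1) less.prems 3 by (auto simp: side_def nth_eq_iff_index_eq)
    then show ?thesis using less.IH[of i] less.prems 3 by (simp add: side_Suc_Suc)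
  qed simp_all
qed

lemma side_disjoint:
  assumes "distinct vs" "Suc j \<le> length vs"
  shows "side vs j \<inter> side vs (Suc j) = {}"
proof -
  have "i = i'" if "i < j" "i' < Suc j" "vs ! i = vs ! i'" for i i'
    using that assms by (simp add: nth_eq_iff_index_eq)
  then show ?thesis unfolding side_def by fastforce
qed

text \<open>The parity lemma, applied to the comparison of M on the two halves of a signed set.\<close>

lemma zigzag_ordering:
  fixes M :: "'a set \<Rightarrow> nat"
  assumes "finite V"
    and mono: "\<And>A B. A \<subseteq> B \<Longrightarrow> B \<subseteq> V \<Longrightarrow> M A \<le> M B"
    and tie: "\<And>A B v. A \<inter> B = {} \<Longrightarrow> A \<union> B \<subseteq> V \<Longrightarrow> v \<in> V - (A \<union> B) \<Longrightarrow> M A = M B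
      \<Longrightarrow> M (insert v A) \<noteq> M A"
  obtains vs where "distinct vs" "set vs = V" "length vs = card V"
    "\<And>j. j < card V \<Longrightarrow> M (side vs j) \<le> M (side vs (Suc j))"
proof -
  define pos where "pos X = {x. (x, True) \<in> X}" for X :: "('a \<times> bool) set"
  define neg where "neg X = {x. (x, False) \<in> X}" for X :: "('a \<times> bool) set"
  \<comment> \<open>A tie of \<open>M\<close> is decided by the half that holds a chosen element of
    the union. The union does not change under negation, so \<open>s\<close> is antipodal.\<close>
  define s where "s X \<longleftrightarrow> M (neg X) < M (pos X) \<or> M (neg X) = M (pos X) \<and> (SOME x. x \<in> pos X \<union> neg X) \<in> pos X"
    for X
  have anti: "s (flip_sign ` set xs) \<longleftrightarrow> \<not> s (set xs)" if ne: "xs \<noteq> []" and dist: "distinct (map fst xs)" for xs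
  proof -
    have flip: "pos (flip_sign ` X) = neg X" "neg (flip_sign ` X) = pos X" for X
      by (force simp: pos_def neg_def flip_sign_def image_iff)+
    have disj: "pos (set xs) \<inter> neg (set xs) = {}"
      using eq_key_imp_eq_value[OF dist] by (auto simp: pos_def neg_def)
    obtain y c where "(y, c) \<in> set xs" using ne by (cases xs) auto
    then have "\<exists>x. x \<in> pos (set xs) \<union> neg (set xs)" by (cases c) (auto simp: pos_def neg_def)
    then have "(SOME x. x \<in> pos (set xs) \<union> neg (set xs)) \<in> pos (set xs) \<union> neg (set xs)" by (rule someI_ex)
    then show ?thesis using disj unfolding s_def flip by (auto simp: Un_commute)
  qed
  have "{xs \<in> signed_orders V. alternating True (chain_signs s xs)} \<noteq> {}"
    using odd_card_alternating_orders[of V s, OF assms(1) anti] by (auto simp del: Collect_empty_eq)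
  then obtain xs where xs: "xs \<in> signed_orders V" "alternating True (chain_signs s xs)" by blast
  have len: "length xs = card V" using xs length_signed_orders by blast
  have dist: "distinct (map fst xs)" and setV: "fst ` set xs = V" using xs by (auto simp: signed_orders_def)
  define P where "P j = pos (set (take j xs))" for j
  define N where "N j = neg (set (take j xs))" for j
  have sg: "s (set (take (Suc j) xs)) \<longleftrightarrow> even j" if "j < card V" for j
    using alternating_nth[OF xs(2), of j] that len by (simp add: chain_signs_nth)
  have geP: "M (N (Suc j)) \<le> M (P (Suc j))" if "j < card V" "even j" for j
    using sg[OF that(1)] that by (auto simp: s_def P_def N_def)
  have geN: "M (P (Suc j)) \<le> M (N (Suc j))" if "j < card V" "odd j" for j
    using sg[OF that(1)] that by (auto simp: s_def P_def N_def)
  have subV: "P j \<subseteq> V" "N j \<subseteq> V" for j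
    using setV by (auto simp: P_def N_def pos_def neg_def dest!: in_set_takeD) force+
  have disj: "P j \<inter> N j = {}" for j
  proof -
    have "distinct (map fst (take j xs))" using dist by (simp add: take_map[symmetric])
    then show ?thesis
      using eq_key_imp_eq_value[of "take j xs"] by (auto simp: P_def N_def pos_def neg_def)
  qed
  have step: "P (Suc j) = (if snd (xs ! j) then insert (fst (xs ! j)) (P j) else P j)"
    "N (Suc j) = (if snd (xs ! j) then N j else insert (fst (xs ! j)) (N j))" if "j < card V" for j
    using that len by (cases "xs ! j"; auto simp: P_def N_def pos_def neg_def take_Suc_conv_app_nth)+
  have new: "fst (xs ! j) \<in> V - (P j \<union> N j)" if "j < card V" for j
  proof -
    have "fst (xs ! j) \<notin> set (take j (map fst xs))"
      using distinct_take[OF dist, of "Suc j"] that len by (simp add: take_Suc_conv_app_nth)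
    moreover have "P j \<union> N j \<subseteq> fst ` set (take j xs)" by (force simp: P_def N_def pos_def neg_def)
    ultimately have "fst (xs ! j) \<notin> P j \<union> N j" by (auto simp: take_map)
    then show ?thesis using that len setV by auto
  qed
  \<comment> \<open>Each new element joins the half that the sign favours after its arrival.
    Otherwise the half that was already at least as large in \<open>M\<close> grows and yet must not
    exceed the other; monotonicity then makes all values equal, which \<open>tie\<close>
    excludes.\<close>
  have turn: "snd (xs ! j) \<longleftrightarrow> even j" if j: "j < card V" for j
  proof (rule ccontr)
    assume wrong: "\<not> (snd (xs ! j) \<longleftrightarrow> even j)"
    show False
    proof (cases "even j")
      case True
      have "M (P j) \<le> M (N j)"
        using geN[of "j - 1"] True j by (cases j) (auto simp: P_def N_def pos_def neg_def)
      moreover have S: "P (Suc j) = P j" "N (Suc j) = insert (fst (xs ! j)) (N j)"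
        using step[OF j] wrong True by auto
      moreover have "M (N (Suc j)) \<le> M (P (Suc j))" by (rule geP[OF j True])
      moreover have "M (N j) \<le> M (N (Suc j))" by (metis mono S(2) subV(2) subset_insertI)
      ultimately show False
        using tie[of "N j" "P j" "fst (xs ! j)"] new[OF j] disj[of j] subV[of j] by auto
    next
      case False
      have "M (N j) \<le> M (P j)"
        using geP[of "j - 1"] False j by (cases j) auto
      moreover have S: "N (Suc j) = N j" "P (Suc j) = insert (fst (xs ! j)) (P j)"
        using step[OF j] wrong False by auto
      moreover have "M (P (Suc j)) \<le> M (N (Suc j))" by (rule geN[OF j False])
      moreover have "M (P j) \<le> M (P (Suc j))" by (metis mono S(2) subV(1) subset_insertI)
      ultimately show False
        using tie[of "P j" "N j" "fst (xs ! j)"] new[OF j] disj[of j] subV[of j] by auto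
    qed
  qed
  have sides: "side (map fst xs) (Suc j) = (if even j then P (Suc j) else N (Suc j)) \<and>
      side (map fst xs) j = (if even j then N (Suc j) else P (Suc j))" if "j < card V" for j
    using that
  proof (induction j)
    case 0
    then show ?case using step[of 0] turn[of 0] len by (auto simp: P_def N_def pos_def neg_def)
  next
    case (Suc j)
    then show ?case using step[of "Suc j"] turn[of "Suc j"] len by (auto simp: side_Suc_Suc)
  qed
  show ?thesis
  proof (rule that[of "map fst xs"])
    show "M (side (map fst xs) j) \<le> M (side (map fst xs) (Suc j))" if "j < card V" for j
      using sides[OF that] geP[OF that] geN[OF that] by auto
  qed (use dist setV len in auto)
qed

definition max_colour :: "nat \<Rightarrow> ('a set \<Rightarrow> nat) \<Rightarrow> 'a set \<Rightarrow> nat" where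
  "max_colour k c A = Max (c ` {S. S \<subseteq> A \<and> card S = k})"

lemma max_colour_props:
  assumes "finite A" "k \<le> card A"
  shows max_colour_attained: "\<exists>S. S \<subseteq> A \<and> card S = k \<and> c S = max_colour k c A"
    and max_colour_mono: "A \<subseteq> B \<Longrightarrow> finite B \<Longrightarrow> max_colour k c A \<le> max_colour k c B"
proof -
  have fin: "finite {S. S \<subseteq> B \<and> card S = k}" if "finite B" for B :: "'a set"
    using that by (rule finite_subset[rotated, OF finite_Pow_iff[THEN iffD2]]) auto
  obtain S where S: "S \<subseteq> A" "card S = k" using assms obtain_subset_with_card_n by metis
  then have "c ` {S. S \<subseteq> A \<and> card S = k} \<noteq> {}" by blast
  then have "max_colour k c A \<in> c ` {S. S \<subseteq> A \<and> card S = k}"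
    unfolding max_colour_def using fin[OF assms(1)] by (intro Max_in) auto
  then show "\<exists>S. S \<subseteq> A \<and> card S = k \<and> c S = max_colour k c A" by auto
  show "max_colour k c A \<le> max_colour k c B" if "A \<subseteq> B" "finite B"
    unfolding max_colour_def using fin[OF that(2)] S that by (intro Max_mono) auto
qed

text \<open>Disjoint sets with at least \<open>k\<close> elements have different maximal colours,
  since the subsets attaining them are disjoint. So the inequalities of
  \<open>zigzag_ordering\<close> become strict as soon as both halves have \<open>k\<close>
  elements, which happens at \<open>j = 2 * k - 1\<close>.\<close>

lemma kneser_zigzag:
  fixes c :: "'a set \<Rightarrow> nat"
  assumes "finite V" "0 < k"
    and proper: "\<And>S T. S \<subseteq> V \<Longrightarrow> T \<subseteq> V \<Longrightarrow> S \<inter> T = {} \<Longrightarrow> card S = k \<Longrightarrow> card T = k \<Longrightarrow> c S \<noteq> c T"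
  obtains vs where "distinct vs" "set vs = V" "length vs = card V"
    "\<And>j. 2 * k - 1 \<le> j \<Longrightarrow> j < card V \<Longrightarrow> max_colour k c (side vs j) < max_colour k c (side vs (Suc j))"
proof -
  \<comment> \<open>Sets without a \<open>k\<close>-subset are valued by their size, below all the
    shifted colours. An insertion always changes such a value, so \<open>tie\<close> holds there as
    well.\<close>
  define M where "M A = (if card A < k then card A else k + max_colour k c A)" for A
  have neq: "max_colour k c A \<noteq> max_colour k c B"
    if AB: "A \<subseteq> V" "B \<subseteq> V" "A \<inter> B = {}" "k \<le> card A" "k \<le> card B" for A B
  proof -
    have fin: "finite A" "finite B" using AB assms(1) by (auto intro: finite_subset)
    obtain S where S: "S \<subseteq> A" "card S = k" "c S = max_colour k c A"
      using max_colour_attained[OF fin(1) AB(4)] by metis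
    obtain T where T: "T \<subseteq> B" "card T = k" "c T = max_colour k c B"
      using max_colour_attained[OF fin(2) AB(5)] by metis
    have "c S \<noteq> c T" by (rule proper) (use S T AB in auto)
    then show ?thesis using S T by simp
  qed
  have mono: "M A \<le> M B" if "A \<subseteq> B" "B \<subseteq> V" for A B
  proof -
    have "finite B" using that assms(1) finite_subset by blast
    then have "finite A" "card A \<le> card B" using that by (auto intro: finite_subset card_mono)
    then show ?thesis
      using max_colour_mono[of A k B c] that \<open>finite B\<close> by (auto simp: M_def)
  qed
  have tie: "M (insert v A) \<noteq> M A"
    if "A \<inter> B = {}" "A \<union> B \<subseteq> V" "v \<in> V - (A \<union> B)" "M A = M B" for A B v
  proof (cases "card A < k")
    case True
    have "card (insert v A) = Suc (card A)"
      using that assms(1) by (intro card_insert_disjoint) (auto intro: finite_subset)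
    then show ?thesis using True by (simp add: M_def)
  next
    case False
    then have "k \<le> card B" using that(4) by (auto simp: M_def split: if_splits)
    then show ?thesis using neq[of A B] False that by (auto simp: M_def)
  qed
  show ?thesis
  proof (rule zigzag_ordering[of V M])
    fix vs assume vs: "distinct vs" "set vs = V" "length vs = card V"
      and le: "\<And>j. j < card V \<Longrightarrow> M (side vs j) \<le> M (side vs (Suc j))"
    show ?thesis
    proof (rule that[OF vs])
      fix j assume j: "2 * k - 1 \<le> j" "j < card V"
      have "card (side vs j) = Suc j div 2" "card (side vs (Suc j)) = Suc (Suc j) div 2"
        using j vs by (simp_all add: card_side)
      then have "k \<le> card (side vs j)" "k \<le> card (side vs (Suc j))" using j assms(2) by linarith+
      moreover have "side vs j \<subseteq> V" "side vs (Suc j) \<subseteq> V" "side vs j \<inter> side vs (Suc j) = {}"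
        using side_subset[of _ vs] side_disjoint[of vs j] j vs by auto
      ultimately show "max_colour k c (side vs j) < max_colour k c (side vs (Suc j))"
        using neq[of "side vs j" "side vs (Suc j)"] le[OF j(2)] by (auto simp: M_def)
    qed
  qed (use assms(1) mono tie in blast)+
qed

lemma strict_mono_chain_add:
  fixes f :: "nat \<Rightarrow> nat"
  assumes "\<And>j. a \<le> j \<Longrightarrow> j < b \<Longrightarrow> f j < f (Suc j)" "a \<le> i" "i < j" "j \<le> b"
  shows "f i < f j"
  using assms(3,4)
proof (induction j)
  case (Suc j)
  show ?case
  proof (cases "i = j")
    case True
    then show ?thesis using assms(1)[of j] assms(2) Suc by simp
  next
    case False
    then have "f i < f j" using Suc by simp
    also have "\<dots> < f (Suc j)" using assms(1)[of j] assms(2) Suc by simp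
    finally show ?thesis .
  qed
qed simp

text \<open>Without a monochromatic disjoint pair the zig-zag ordering shows strictly increasing
  colours at the positions \<open>2 * k - 1\<close> to \<open>card V\<close>, hence
  \<open>card V - 2 * k + 2\<close> different colours.\<close>

theorem kneser:
  fixes c :: "'a set \<Rightarrow> 'b"
  assumes "finite V" "0 < k"
    and few: "card (c ` {S. S \<subseteq> V \<and> card S = k}) + 2 * k < card V + 2"
    and big: "2 * k \<le> card V"
  shows "\<exists>S T. S \<subseteq> V \<and> T \<subseteq> V \<and> S \<inter> T = {} \<and> card S = k \<and> card T = k \<and> c S = c T"
proof (rule ccontr)
  assume none: "\<not> ?thesis"
  define C where "C = c ` {S. S \<subseteq> V \<and> card S = k}"
  have finC: "finite C"
    unfolding C_def using assms(1)
    by (intro finite_imageI) (rule finite_subset[of _ "Pow V"], auto)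
  obtain r where r: "bij_betw r C {0..<card C}" using ex_bij_betw_finite_nat[OF finC] by blast
  define c' where "c' = r \<circ> c"
  have "c' S \<noteq> c' T" if "S \<subseteq> V" "T \<subseteq> V" "S \<inter> T = {}" "card S = k" "card T = k" for S T
  proof -
    have "c S \<noteq> c T" using none that by blast
    moreover have "c S \<in> C" "c T \<in> C" using that by (auto simp: C_def)
    ultimately show ?thesis using r unfolding c'_def bij_betw_def inj_on_def by auto
  qed
  then obtain vs where vs: "distinct vs" "set vs = V" "length vs = card V"
    and less: "\<And>j. 2 * k - 1 \<le> j \<Longrightarrow> j < card V \<Longrightarrow> max_colour k c' (side vs j) < max_colour k c' (side vs (Suc j))"
    using kneser_zigzag[of V k c'] assms(1,2) by metis
  define f where "f j = max_colour k c' (side vs j)" for j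
  have "inj_on f {2 * k - 1..card V}"
  proof (rule inj_onI)
    fix i j assume "i \<in> {2 * k - 1..card V}" "j \<in> {2 * k - 1..card V}" "f i = f j"
    then show "i = j"
      using strict_mono_chain_add[of "2 * k - 1" "card V" f i j]
        strict_mono_chain_add[of "2 * k - 1" "card V" f j i] less
      by (cases i j rule: linorder_cases) (auto simp: f_def)
  qed
  then have "card (f ` {2 * k - 1..card V}) = card V + 2 - 2 * k"
    using assms(2) big by (simp add: card_image)
  moreover have "f ` {2 * k - 1..card V} \<subseteq> {0..<card C}"
  proof
    fix y assume "y \<in> f ` {2 * k - 1..card V}"
    then obtain j where j: "2 * k - 1 \<le> j" "j \<le> card V" "y = f j" by auto
    have "k \<le> card (side vs j)" using j vs assms(2) by (simp add: card_side)
    then obtain S where S: "S \<subseteq> side vs j" "card S = k" "c' S = y"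
      using max_colour_attained[of "side vs j" k c'] j by (auto simp: f_def)
    have "S \<subseteq> V" using S side_subset[of j vs] j vs by auto
    then have "c S \<in> C" using S by (auto simp: C_def)
    then show "y \<in> {0..<card C}" using r S by (auto simp: c'_def bij_betw_def)
  qed
  then have "card (f ` {2 * k - 1..card V}) \<le> card {0..<card C}" by (intro card_mono) auto
  ultimately show False using few big by (simp add: C_def)
qed

subsection \<open>Edge numbers in vertex sets\<close>

text \<open>A bare relation with the vertex set as an argument: the arguments below pass to
  neighbourhoods and delete vertices, and this way they need no new graph.\<close>

locale adjacency =
  fixes adj :: "'a \<Rightarrow> 'a \<Rightarrow> bool"
  assumes adj_sym: "adj u v \<Longrightarrow> adj v u"
    and adj_irrefl: "\<not> adj v v"
begin

definition inner_edges :: "'a set \<Rightarrow> 'a set set" where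
  "inner_edges A = {P. \<exists>u\<in>A. \<exists>v\<in>A. adj u v \<and> P = {u, v}}"

definition nbrs :: "'a \<Rightarrow> 'a set \<Rightarrow> 'a set" where
  "nbrs v A = {w \<in> A. adj v w}"

lemma adj_commute: "adj u v \<longleftrightarrow> adj v u"
  using adj_sym by blast

lemma nbrs_subset: "nbrs v A \<subseteq> A"
  by (auto simp: nbrs_def)

lemma finite_nbrs [simp]: "finite A \<Longrightarrow> finite (nbrs v A)"
  by (simp add: nbrs_def)

lemma card_nbrs_le: "finite A \<Longrightarrow> card (nbrs v A) \<le> card A"
  by (simp add: card_mono nbrs_subset)

lemma finite_inner_edges [simp]: "finite A \<Longrightarrow> finite (inner_edges A)"
  by (rule finite_subset[of _ "Pow A"]) (auto simp: inner_edges_def)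

lemma inner_edges_empty [simp]: "inner_edges {} = {}"
  by (simp add: inner_edges_def)

lemma inner_edges_mono: "A \<subseteq> B \<Longrightarrow> inner_edges A \<subseteq> inner_edges B"
  by (auto simp: inner_edges_def)

lemma card_inner_edges_mono: "A \<subseteq> B \<Longrightarrow> finite B \<Longrightarrow> card (inner_edges A) \<le> card (inner_edges B)"
  by (simp add: card_mono inner_edges_mono)

lemma card_inner_edges_insert:
  assumes "finite A" "v \<notin> A"
  shows "card (inner_edges (insert v A)) = card (inner_edges A) + card (nbrs v A)"
proof -
  have "inner_edges (insert v A) = inner_edges A \<union> (\<lambda>w. {v, w}) ` nbrs v A"
    using adj_irrefl adj_sym by (auto simp: inner_edges_def nbrs_def)
  moreover have "inner_edges A \<inter> (\<lambda>w. {v, w}) ` nbrs v A = {}"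
    using assms(2) by (auto simp: inner_edges_def doubleton_eq_iff)
  moreover have "card ((\<lambda>w. {v, w}) ` nbrs v A) = card (nbrs v A)"
    by (intro card_image) (auto intro: inj_onI simp: doubleton_eq_iff)
  ultimately show ?thesis using assms by (simp add: card_Un_disjoint)
qed

lemma nbrs_insert: "nbrs u (insert v A) = (if adj u v then insert v (nbrs u A) else nbrs u A)"
  by (auto simp: nbrs_def)

lemma nbrs_empty [simp]: "nbrs v {} = {}"
  by (simp add: nbrs_def)

lemma card_nbrs_insert:
  "finite A \<Longrightarrow> v \<notin> A \<Longrightarrow> card (nbrs u (insert v A)) = card (nbrs u A) + of_bool (adj u v)"
  by (simp add: nbrs_insert card_insert_if) (simp add: nbrs_def)

lemma handshake:
  assumes "finite A"
  shows "(\<Sum>v\<in>A. card (nbrs v A)) = 2 * card (inner_edges A)"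
  using assms
proof (induction A rule: finite_induct)
  case (insert v A)
  have "(\<Sum>u\<in>A. card (nbrs u (insert v A))) = (\<Sum>u\<in>A. card (nbrs u A)) + (\<Sum>u\<in>A. of_bool (adj u v))"
    using insert by (simp add: card_nbrs_insert sum.distrib)
  moreover have "(\<Sum>u\<in>A. of_bool (adj u v)) = card (nbrs v A)"
    using insert by (simp add: of_bool_def sum.If_cases nbrs_def Int_def adj_commute)
  moreover have "nbrs v (insert v A) = nbrs v A"
    using adj_irrefl by (simp add: nbrs_insert)
  ultimately show ?case using insert by (simp add: card_inner_edges_insert)
qed simp

lemma card_inner_edges_le: "finite A \<Longrightarrow> card (inner_edges A) \<le> card A choose 2"
proof (induction A rule: finite_induct)
  case (insert v A)
  then show ?case
    using card_nbrs_le[of A v] by (simp add: card_inner_edges_insert numeral_2_eq_2)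
qed simp

text \<open>Unless \<open>S\<close> lies in \<open>T\<close>, it has one vertex outside
  \<open>T\<close>, and that vertex carries at most \<open>k - 1\<close> edges of
  \<open>S\<close>.\<close>

lemma card_inner_edges_near:
  assumes "finite Y" "card Y = Suc k" "S \<subseteq> Y" "T \<subseteq> Y" "card S = k" "card T = k"
  shows "card (inner_edges S) \<le> card (inner_edges T) + (k - 1)"
proof (cases "S \<subseteq> T")
  case True
  then show ?thesis
    using card_inner_edges_mono[OF True] assms finite_subset trans_le_add1 by metis
next
  case False
  then obtain s where s: "s \<in> S" "s \<notin> T" by blast
  have fin: "finite S" "finite T" using assms by (auto intro: finite_subset)
  have "insert s T = Y"
    using s assms fin by (intro card_subset_eq) auto
  then have "S - {s} \<subseteq> T" using assms by auto
  have "card (inner_edges S) = card (inner_edges (S - {s})) + card (nbrs s (S - {s}))"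
    using card_inner_edges_insert[of "S - {s}" s] s fin by (simp add: insert_absorb)
  also have "\<dots> \<le> card (inner_edges T) + card (S - {s})"
    using \<open>S - {s} \<subseteq> T\<close> fin by (intro add_mono card_inner_edges_mono card_nbrs_le) auto
  finally show ?thesis using s fin assms by simp
qed

text \<open>The induced path on three vertices with middle vertex \<open>y\<close>. It spans two
  edges and a \<open>triangle\<close> three, so disjoint triples of the same kind have equal edge
  numbers, with all distances at most 2.\<close>

definition cherry :: "'a \<Rightarrow> 'a \<Rightarrow> 'a \<Rightarrow> bool" where
  "cherry x y z \<longleftrightarrow> x \<noteq> z \<and> adj x y \<and> adj y z \<and> \<not> adj x z"

definition triangle :: "'a \<Rightarrow> 'a \<Rightarrow> 'a \<Rightarrow> bool" where
  "triangle x y z \<longleftrightarrow> adj x y \<and> adj y z \<and> adj x z"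

definition disjoint_triples :: "('a \<Rightarrow> 'a \<Rightarrow> 'a \<Rightarrow> bool) \<Rightarrow> 'a set \<Rightarrow> bool" where
  "disjoint_triples R V \<longleftrightarrow> (\<exists>x y z x' y' z'. R x y z \<and> R x' y' z' \<and>
     {x, y, z, x', y', z'} \<subseteq> V \<and> {x, y, z} \<inter> {x', y', z'} = {})"

lemma disjoint_triples_mono:
  assumes "disjoint_triples R W" "W \<subseteq> V"
  shows "disjoint_triples R V"
proof -
  obtain x y z x' y' z' where "R x y z" "R x' y' z'" "{x, y, z, x', y', z'} \<subseteq> W"
    "{x, y, z} \<inter> {x', y', z'} = {}"
    using assms(1) by (auto simp: disjoint_triples_def)
  then show ?thesis
    unfolding disjoint_triples_def using subset_trans[OF _ assms(2)] by (intro exI conjI)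
qed

lemma disjoint_triplesI:
  assumes "R x y z" "R x' y' z'" "{x, y, z, x', y', z'} \<subseteq> V" "{x, y, z} \<inter> {x', y', z'} = {}"
  shows "disjoint_triples R V"
  unfolding disjoint_triples_def using assms by (intro exI conjI)

lemma clique_disjoint_triangles:
  assumes "K \<subseteq> V" "6 \<le> card K" and clique: "\<And>u v. u \<in> K \<Longrightarrow> v \<in> K \<Longrightarrow> u \<noteq> v \<Longrightarrow> adj u v"
  shows "disjoint_triples triangle V"
proof -
  have fin: "finite K" using assms(2) by (intro card_ge_0_finite) simp
  obtain S where "S \<subseteq> K" "card S = 3" using obtain_subset_with_card_n[of 3 K] assms(2) by auto
  then have "3 \<le> card (K - S)"
    using assms(2) fin by (simp add: card_Diff_subset finite_subset)
  then obtain T where "T \<subseteq> K - S" "card T = 3" using obtain_subset_with_card_n[of 3 "K - S"] by blast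
  obtain a b c where S: "S = {a, b, c}" "a \<noteq> b" "b \<noteq> c" "a \<noteq> c"
    using \<open>card S = 3\<close> card_3_iff by metis
  obtain a' b' c' where T: "T = {a', b', c'}" "a' \<noteq> b'" "b' \<noteq> c'" "a' \<noteq> c'"
    using \<open>card T = 3\<close> card_3_iff by metis
  have "triangle a b c" "triangle a' b' c'"
    unfolding triangle_def using S T \<open>S \<subseteq> K\<close> \<open>T \<subseteq> K - S\<close> by (auto intro!: clique)
  then show ?thesis
    using S T \<open>S \<subseteq> K\<close> \<open>T \<subseteq> K - S\<close> assms(1)
    by (intro disjoint_triplesI[of triangle a b c a' b' c']) auto
qed

end

subsection \<open>Disjoint induced paths and triangles in dense graphs\<close>

text \<open>A smallest counterexample with a cherry, except for its density; \<open>sparse\<close>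
  shows that density is then impossible. Below, x, y, z are called base vertices and edges between
  them and \<open>U\<close> cross edges.\<close>

locale cherry_packing = adjacency +
  fixes V :: "'a set" and x y z :: 'a
  assumes finV: "finite V"
    and min_degree: "v \<in> V \<Longrightarrow> 3 \<le> card (nbrs v V)"
    and no_cherries: "\<not> disjoint_triples cherry V"
    and no_triangles: "\<not> disjoint_triples triangle V"
    and base: "cherry x y z" "{x, y, z} \<subseteq> V"
begin

definition U :: "'a set" where "U = V - {x, y, z}"

lemma finU [simp]: "finite U"
  using finV by (simp add: U_def)

lemma base_adj: "adj x y" "adj y z" "\<not> adj x z" "adj y x" "adj z y" "\<not> adj z x" "x \<noteq> y" "y \<noteq> z" "x \<noteq> z"
  using base(1) adj_sym adj_irrefl by (auto simp: cherry_def)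

lemma base_not_U [simp]: "x \<notin> U" "y \<notin> U" "z \<notin> U"
  by (auto simp: U_def)

lemma V_eq: "V = insert x (insert y (insert z U))"
  using base by (auto simp: U_def)

lemma cherries_meet:
  assumes "cherry a b c" "cherry a' b' c'" "{a, b, c, a', b', c'} \<subseteq> V"
  shows "{a, b, c} \<inter> {a', b', c'} \<noteq> {}"
  using disjoint_triplesI[of cherry, OF assms] no_cherries by blast

lemma triangles_meet:
  assumes "triangle a b c" "triangle a' b' c'" "{a, b, c, a', b', c'} \<subseteq> V"
  shows "{a, b, c} \<inter> {a', b', c'} \<noteq> {}"
  using disjoint_triplesI[of triangle, OF assms] no_triangles by blast

lemma U_V: "u \<in> U \<Longrightarrow> u \<in> V \<and> u \<noteq> x \<and> u \<noteq> y \<and> u \<noteq> z"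
  by (auto simp: U_def)

lemma base_V: "x \<in> V" "y \<in> V" "z \<in> V"
  using base by auto

text \<open>A cherry inside \<open>U\<close> would be disjoint from x, y, z. So each component of
  \<open>U\<close> is a clique.\<close>

lemma adj_trans_U:
  assumes "a \<in> U" "b \<in> U" "c \<in> U" "adj a b" "adj b c" "a \<noteq> c"
  shows "adj a c"
proof (rule ccontr)
  assume "\<not> adj a c"
  then have "cherry a b c" using assms by (simp add: cherry_def)
  then show False
    using cherries_meet[of x y z a b c] base U_V[OF assms(1)] U_V[OF assms(2)] U_V[OF assms(3)] by auto
qed

lemma card_V: "card V = card U + 3"
  using arg_cong[OF V_eq, of card] base_adj by simp

lemma degree_split:
  "u \<in> U \<Longrightarrow> 3 \<le> card (nbrs u U) + of_bool (adj u x) + of_bool (adj u y) + of_bool (adj u z)"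
  using min_degree[of u] base_adj arg_cong[OF V_eq, of "nbrs u"] U_V[of u] by (simp add: card_nbrs_insert)

lemma two_base_nbrs:
  assumes "u \<in> U" "card (nbrs u U) \<le> 1"
  shows "adj u x \<and> adj u y \<or> adj u x \<and> adj u z \<or> adj u y \<and> adj u z"
  using degree_split[OF assms(1)] assms(2) by (cases "adj u x"; cases "adj u y"; cases "adj u z") simp_all

lemma card_inner_edges_V:
  "card (inner_edges V) = card (inner_edges U) + card (nbrs x U) + card (nbrs y U) + card (nbrs z U) + 2"
proof -
  have "card (inner_edges V) = card (inner_edges (insert x (insert y (insert z U))))"
    by (rule arg_cong[OF V_eq])
  also have "\<dots> = card (inner_edges U) + card (nbrs z U) + (card (nbrs y U) + 1) + (card (nbrs x U) + 0 + 1)"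
    using base_adj by (simp add: card_inner_edges_insert card_nbrs_insert)
  finally show ?thesis by simp
qed

text \<open>A triangle of U forces all of U to be a clique: a further component would be a single vertex or an
  edge, and would span a second triangle together with x, y, z.\<close>

lemma U_clique:
  assumes abc: "triangle a b c" "a \<in> U" "b \<in> U" "c \<in> U" and uv: "u \<in> U" "v \<in> U" "u \<noteq> v"
  shows "adj u v"
proof -
  have away: "card (nbrs u U) \<le> 1 \<and> (\<forall>w\<in>nbrs u U. w \<noteq> a \<and> \<not> adj w a)"
    if u: "u \<in> U" "u \<noteq> a" "\<not> adj u a" for u
  proof -
    have out: "u \<notin> {a, b, c}" using u abc adj_sym by (auto simp: triangle_def)
    have n: "w \<noteq> a \<and> \<not> adj w a \<and> w \<notin> {a, b, c}" if "w \<in> nbrs u U" for w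
    proof -
      have w: "w \<in> U" "adj u w" using that by (auto simp: nbrs_def)
      then have "\<not> adj w a" using adj_trans_U[of u w a] u abc by blast
      then show ?thesis using w u abc adj_sym by (auto simp: triangle_def)
    qed
    have "w = w'" if w: "w \<in> nbrs u U" "w' \<in> nbrs u U" for w w'
    proof (rule ccontr)
      assume ne: "w \<noteq> w'"
      have m: "w \<in> U" "w' \<in> U" "adj u w" "adj u w'" using w by (auto simp: nbrs_def)
      then have "adj w w'" using adj_trans_U[of w u w'] u ne adj_sym by blast
      then have "triangle u w w'" using m by (simp add: triangle_def)
      then show False
        using triangles_meet[OF abc(1), of u w w'] n[OF w(1)] n[OF w(2)] out m u abc U_V by auto
    qed
    then have "card (nbrs u U) \<le> Suc 0" by (simp add: card_le_Suc0_iff_eq)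
    then show ?thesis using n by auto
  qed
  have all: "u = a \<or> adj u a" if u: "u \<in> U" for u
  proof (rule ccontr)
    assume na: "\<not> (u = a \<or> adj u a)"
    have out: "u \<notin> {a, b, c}" using na abc adj_sym by (auto simp: triangle_def)
    show False
    proof (cases "nbrs u U = {}")
      case True
      then have "adj u x" "adj u y" using degree_split[OF u] by (auto simp: of_bool_def split: if_splits)
      then have "triangle u x y" using base_adj by (simp add: triangle_def)
      then show False
        using triangles_meet[OF abc(1), of u x y] out U_V[OF abc(2)] U_V[OF abc(3)] U_V[OF abc(4)]
          U_V[OF u] base_V by auto
    next
      case False
      then obtain w where w: "w \<in> nbrs u U" by blast
      have wU: "w \<in> U" "adj u w" using w by (auto simp: nbrs_def)
      have "w \<noteq> a" "\<not> adj w a" using away[OF u] na w by auto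
      then have wout: "w \<notin> {a, b, c}" using abc adj_sym by (auto simp: triangle_def)
      have "card (nbrs u U) \<le> 1" "card (nbrs w U) \<le> 1"
        using away[OF u] away[OF wU(1)] na \<open>w \<noteq> a\<close> \<open>\<not> adj w a\<close> by auto
      \<comment> \<open>Each end of the edge has at least two of the three base vertices as
        neighbours, so they share one.\<close>
      then obtain p where p: "p \<in> {x, y, z}" "adj u p" "adj w p"
        using two_base_nbrs[OF u] two_base_nbrs[OF wU(1)] by blast
      then have "triangle u w p" using wU by (simp add: triangle_def)
      then show False
        using triangles_meet[OF abc(1), of u w p] out wout p U_V[OF abc(2)] U_V[OF abc(3)] U_V[OF abc(4)]
          U_V[OF u] U_V[OF wU(1)] base_V by auto
    qed
  qed
  show ?thesis
    using all[OF uv(1)] all[OF uv(2)] adj_trans_U[of u a v] uv abc(2) adj_sym by blast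
qed

lemma clique_case:
  assumes clique: "\<And>u v. u \<in> U \<Longrightarrow> v \<in> U \<Longrightarrow> u \<noteq> v \<Longrightarrow> adj u v" and "3 \<le> card U"
  shows "card (inner_edges V) \<le> 2 * card V"
proof -
  have tri: "triangle a b c" if "a \<in> U" "b \<in> U" "c \<in> U" "a \<noteq> b" "b \<noteq> c" "a \<noteq> c" for a b c
    using that clique by (simp add: triangle_def)
  have meet: False
    if "{a, b, c} \<subseteq> U" "{d, e} \<subseteq> U" "p \<in> {x, y, z}" "adj d p" "adj e p" "distinct [a, b, c, d, e]" for a b c d e p
  proof -
    have "triangle d e p" using that clique by (simp add: triangle_def)
    moreover have "triangle a b c" using that by (intro tri) auto
    ultimately show False
      using triangles_meet[of a b c d e p] that U_V base_V by auto
  qed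
  \<comment> \<open>Both x and z are adjacent to y, so \<open>d\<close> closes a triangle with y and
    either of them, and three vertices of the clique are left for a second triangle.\<close>
  have meet2: False
    if A: "{a, b, c, d} \<subseteq> U" "adj d y" "adj d x \<or> adj d z" "distinct [a, b, c, d]" for a b c d
  proof -
    have "\<exists>p\<in>{x, z}. triangle d y p"
      using A base_adj by (auto simp: triangle_def)
    then obtain p where "p \<in> {x, z}" "triangle d y p" by blast
    moreover have "triangle a b c" using A by (intro tri) auto
    ultimately show False
      using triangles_meet[of a b c d y p] A U_V base_V by auto
  qed
  have "card U \<le> 5"
    using clique_disjoint_triangles[of U V] clique no_triangles by (fastforce simp: U_def)
  then consider "card U = 3" | "card U = 4" | "card U = 5" using assms(2) by linarith
  then show ?thesis
  proof cases
    case 1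
    then obtain a b c where abc: "U = {a, b, c}" "a \<noteq> b" "b \<noteq> c" "a \<noteq> c" by (metis card_3_iff)
    \<comment> \<open>With six vertices, and at most 3 + 2 edges inside \<open>U\<close> and inside
      the cherry, it suffices to exclude eight cross edges. If at most one of the nine cross pairs
      is not adjacent, some choice of \<open>p\<close> has the pattern refuted here.\<close>
    have no: "\<not> (adj p x \<and> adj p y \<and> adj q z \<and> adj r z)" if "{p, q, r} = U" "distinct [p, q, r]" for p q r
    proof
      assume A: "adj p x \<and> adj p y \<and> adj q z \<and> adj r z"
      have "triangle p x y" "triangle q r z"
        using A base_adj that clique by (auto simp: triangle_def)
      then show False
        using triangles_meet[of p x y q r z] that U_V base_V base_adj by auto
    qed
    have "\<not> (adj a x \<and> adj a y \<and> adj b z \<and> adj c z)" "\<not> (adj b x \<and> adj b y \<and> adj a z \<and> adj c z)"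
      "\<not> (adj c x \<and> adj c y \<and> adj a z \<and> adj b z)"
      using abc by (intro no; auto)+
    moreover have "card (nbrs p U) = of_bool (adj a p) + of_bool (adj b p) + of_bool (adj c p)" for p
      using abc by (simp add: card_nbrs_insert adj_commute)
    moreover have "card (inner_edges U) \<le> 3"
      using card_inner_edges_le[of U] 1 by (simp add: choose_two)
    ultimately show ?thesis
      unfolding card_inner_edges_V card_V 1 by (auto simp: of_bool_def)
  next
    case 2
    then obtain a where a: "a \<in> U" by fastforce
    then have "card (U - {a}) = 3" using 2 by simp
    then obtain b c d where "U - {a} = {b, c, d}" "b \<noteq> c" "c \<noteq> d" "b \<noteq> d" by (metis card_3_iff)
    then have abcd: "U = {a, b, c, d}" "distinct [a, b, c, d]" using a by auto
    define val :: "'a \<Rightarrow> nat" where "val q = of_bool (adj q x) + of_bool (adj q y) + of_bool (adj q z)" for q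
    have excl: "\<not> (adj q y \<and> (adj q x \<or> adj q z))" if q: "q \<in> U" for q
    proof -
      have "card (U - {q}) = 3" using 2 q by simp
      then obtain p r s where "U - {q} = {p, r, s}" "p \<noteq> r" "r \<noteq> s" "p \<noteq> s" by (metis card_3_iff)
      then show ?thesis using meet2[of p r s q] q by auto
    qed
    have val2: "adj q x \<and> adj q z \<and> \<not> adj q y" if "q \<in> U" "val q = 2" for q
      using that excl[of q] by (cases "adj q x"; cases "adj q y"; cases "adj q z") (simp_all add: val_def)
    have key: False
      if U: "{p, q, r, s} = U" "distinct [p, q, r, s]" and v: "val p = 2" "val q = 2" "val r = 2" "1 \<le> val s"
      for p q r s
    proof -
      have full: "adj p x" "adj p z" "adj q x" "adj q z" "adj r x" "adj r z" "\<not> adj q y"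
        using val2[of p] val2[of q] val2[of r] v U by auto
      have cl: "adj s p" "adj q r" "adj s q" using clique U by auto
      consider "adj s x" | "adj s z" | "adj s y"
        using v(4) by (cases "adj s x"; cases "adj s y"; cases "adj s z") (simp_all add: val_def)
      then show False
      proof cases
        case 1
        have "triangle s x p" "triangle q r z" using 1 full cl adj_sym by (auto simp: triangle_def)
        then show False using triangles_meet[of s x p q r z] U U_V base_V base_adj by auto
      next
        case 2
        have "triangle s z p" "triangle q r x" using 2 full cl adj_sym by (auto simp: triangle_def)
        then show False using triangles_meet[of s z p q r x] U U_V base_V base_adj by auto
      next
        case 3
        have "cherry x p z" using full base_adj adj_sym by (auto simp: cherry_def)
        moreover have "cherry y s q" using 3 full cl adj_sym U U_V by (auto simp: cherry_def)
        ultimately show False using cherries_meet[of x p z y s q] U U_V base_V base_adj by auto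
      qed
    qed
    \<comment> \<open>With seven vertices, and at most 6 + 2 edges inside \<open>U\<close> and
      inside the cherry, six cross edges are allowed. Since \<open>excl\<close> leaves at most two
      base neighbours per vertex, seven would force the pattern excluded by
      \<open>key\<close>.\<close>
    have "\<not> 7 \<le> val a + val b + val c + val d"
    proof
      assume 7: "7 \<le> val a + val b + val c + val d"
      have "val q \<le> 2" if "q \<in> U" for q
        using excl[OF that] by (auto simp: val_def)
      then have "val a \<le> 2" "val b \<le> 2" "val c \<le> 2" "val d \<le> 2" using abcd by auto
      then consider "val a = 2" "val b = 2" "val c = 2" "1 \<le> val d" | "val a = 2" "val b = 2" "val d = 2" "1 \<le> val c"
        | "val a = 2" "val c = 2" "val d = 2" "1 \<le> val b" | "val b = 2" "val c = 2" "val d = 2" "1 \<le> val a"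
        using 7 by linarith
      then show False
      proof cases
        case 1
        then show False by (intro key[of a b c d]) (use abcd in auto)
      next
        case 2
        then show False by (intro key[of a b d c]) (use abcd in auto)
      next
        case 3
        then show False by (intro key[of a c d b]) (use abcd in auto)
      next
        case 4
        then show False by (intro key[of b c d a]) (use abcd in auto)
      qed
    qed
    moreover have "card (nbrs p U) = of_bool (adj a p) + of_bool (adj b p) + of_bool (adj c p) + of_bool (adj d p)" for p
      using abcd by (simp add: card_nbrs_insert adj_commute)
    moreover have "card (inner_edges U) \<le> 6"
      using card_inner_edges_le[of U] 2 by (simp add: choose_two)
    ultimately show ?thesis
      unfolding card_inner_edges_V card_V 2 val_def by simp
  next
    case 3
    \<comment> \<open>Two neighbours of \<open>p\<close> form a triangle with it and leave three
      vertices of the clique. So there are at most three cross edges, and 10 + 3 + 2 is below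
      16.\<close>
    have one: "card (nbrs p U) \<le> 1" if p: "p \<in> {x, y, z}" for p
    proof (rule ccontr)
      assume "\<not> card (nbrs p U) \<le> 1"
      then obtain d e where de: "d \<in> nbrs p U" "e \<in> nbrs p U" "d \<noteq> e"
        by (metis One_nat_def card_le_Suc0_iff_eq finU finite_nbrs)
      have "card (U - {d, e}) = 3"
        using de 3 nbrs_subset[of p U] by (subst card_Diff_subset) auto
      then obtain a b c where "U - {d, e} = {a, b, c}" "a \<noteq> b" "b \<noteq> c" "a \<noteq> c" by (metis card_3_iff)
      then show False
        using meet[of a b c d e p] de p adj_sym by (auto simp: nbrs_def)
    qed
    have "card (inner_edges U) \<le> 10"
      using card_inner_edges_le[of U] 3 by (simp add: choose_two)
    then show ?thesis
      unfolding card_inner_edges_V card_V using one[of x] one[of y] one[of z] 3 by simp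
  qed
qed

end

section \<open>The case in which \<open>U\<close> contains no triangle\<close>

context cherry_packing
begin

text \<open>By transitivity two neighbours of a vertex of \<open>U\<close> would be adjacent and
  close a triangle. So \<open>U\<close> induces a matching.\<close>

lemma no_triangle_matching:
  assumes no: "\<And>a b c. a \<in> U \<Longrightarrow> b \<in> U \<Longrightarrow> c \<in> U \<Longrightarrow> \<not> triangle a b c"
  shows matching: "u \<in> U \<Longrightarrow> card (nbrs u U) \<le> 1"
    and one_nbr: "u \<in> U \<Longrightarrow> v \<in> U \<Longrightarrow> w \<in> U \<Longrightarrow> adj u v \<Longrightarrow> adj u w \<Longrightarrow> v = w"
proof -
  show 1: "v = w" if "u \<in> U" "v \<in> U" "w \<in> U" "adj u v" "adj u w" for u v w
  proof (rule ccontr)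
    assume "v \<noteq> w"
    then have "adj v w" using adj_trans_U[of v u w] that adj_sym by blast
    then show False using no[of u v w] that by (simp add: triangle_def)
  qed
  show "card (nbrs u U) \<le> 1" if "u \<in> U" for u
    using 1[OF that] by (simp add: card_le_Suc0_iff_eq) (auto simp: nbrs_def)
qed

text \<open>Nonadjacent \<open>b\<close>, \<open>c\<close> with a common base neighbour form a
  cherry, and the triple of \<open>a\<close> with the other two base vertices must not be one. For
  the centres x and z of the next two lemmas those two are adjacent, so \<open>a\<close> must see
  both or neither.\<close>

lemma not_centre_y:
  assumes "a \<in> U" "b \<in> U" "c \<in> U" "a \<noteq> b" "b \<noteq> c" "a \<noteq> c" "\<not> adj b c" "adj b y" "adj c y"
  shows "\<not> (adj a x \<and> adj a z)"
proof
  assume "adj a x \<and> adj a z"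
  then have "cherry x a z" "cherry b y c"
    using assms base_adj adj_sym by (auto simp: cherry_def)
  then show False
    using cherries_meet[of x a z b y c] assms U_V[OF assms(1)] U_V[OF assms(2)] U_V[OF assms(3)] base_V base_adj
    by auto
qed

lemma not_centre_x:
  assumes "a \<in> U" "b \<in> U" "c \<in> U" "a \<noteq> b" "b \<noteq> c" "a \<noteq> c" "\<not> adj b c" "adj b x" "adj c x"
  shows "adj a y = adj a z"
proof (rule ccontr)
  assume "adj a y \<noteq> adj a z"
  then have "cherry a y z \<or> cherry y z a"
    using assms base_adj adj_sym[of a z] U_V[OF assms(1)] adj_sym[of y a] by (auto simp: cherry_def)
  moreover have "cherry b x c" using assms adj_sym by (auto simp: cherry_def)
  ultimately show False
    using cherries_meet[of a y z b x c] cherries_meet[of y z a b x c]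
      assms U_V[OF assms(1)] U_V[OF assms(2)] U_V[OF assms(3)] base_V base_adj
    by auto
qed

lemma not_centre_z:
  assumes "a \<in> U" "b \<in> U" "c \<in> U" "a \<noteq> b" "b \<noteq> c" "a \<noteq> c" "\<not> adj b c" "adj b z" "adj c z"
  shows "adj a x = adj a y"
proof (rule ccontr)
  assume "adj a x \<noteq> adj a y"
  then have "cherry a y x \<or> cherry y x a"
    using assms base_adj adj_sym[of a x] U_V[OF assms(1)] adj_sym[of y a] by (auto simp: cherry_def)
  moreover have "cherry b z c" using assms adj_sym by (auto simp: cherry_def)
  ultimately show False
    using cherries_meet[of a y x b z c] cherries_meet[of y x a b z c]
      assms U_V[OF assms(1)] U_V[OF assms(2)] U_V[OF assms(3)] base_V base_adj
    by auto
qed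

text \<open>Each vertex of such a triple sees y and exactly one of x, z, so degree 3 gives it a
  partner in \<open>U\<close>. Two of the three see the same \<open>q\<close> among x, z and form a
  cherry around \<open>q\<close>; their partners lie in independent triples too, hence see y and
  form a disjoint cherry around y.\<close>

lemma independent_triple:
  assumes no: "\<And>a b c. a \<in> U \<Longrightarrow> b \<in> U \<Longrightarrow> c \<in> U \<Longrightarrow> \<not> triangle a b c"
    and abc: "a \<in> U" "b \<in> U" "c \<in> U" "a \<noteq> b" "b \<noteq> c" "a \<noteq> c" "\<not> adj a b" "\<not> adj b c" "\<not> adj a c"
  shows False
proof -
  \<comment> \<open>Every vertex has two base neighbours. If \<open>a\<close> misses y, it sees x
    and z, so one of the others, say \<open>b\<close>, misses y as well. The common neighbours x and
    z of \<open>a\<close> and \<open>b\<close> then force \<open>c\<close> to see all of x, y, z,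
    and x as common neighbour of \<open>a\<close> and \<open>c\<close> contradicts the type of
    \<open>b\<close>. So all see y, and none sees both x and z.\<close>
  have types: "adj a y \<and> (adj a x \<noteq> adj a z) \<and> adj b y \<and> (adj b x \<noteq> adj b z) \<and> adj c y \<and> (adj c x \<noteq> adj c z)"
    if "a \<in> U" "b \<in> U" "c \<in> U" "a \<noteq> b" "b \<noteq> c" "a \<noteq> c" "\<not> adj a b" "\<not> adj b c" "\<not> adj a c" for a b c
  proof -
    have s: "\<not> adj b a" "\<not> adj c b" "\<not> adj c a" using that adj_sym by blast+
    note t = two_base_nbrs[OF _ matching[OF no]]
    show ?thesis
      using t[of a] t[of b] t[of c]
        not_centre_y[of a b c] not_centre_y[of b a c] not_centre_y[of c a b]
        not_centre_x[of a b c] not_centre_x[of b a c] not_centre_x[of c a b]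
        not_centre_z[of a b c] not_centre_z[of b a c] not_centre_z[of c a b] that s
      by (smt (verit))
  qed
  have partner: "\<exists>u'\<in>U. adj u u'" if "u \<in> U" "adj u x \<noteq> adj u z" for u
  proof (rule ccontr)
    assume "\<not> ?thesis"
    then have "nbrs u U = {}" by (auto simp: nbrs_def)
    then show False using degree_split[OF that(1)] that(2) by (cases "adj u y"; cases "adj u x"; cases "adj u z") simp_all
  qed
  have key: False
    if A: "a \<in> U" "b \<in> U" "c \<in> U" "a \<noteq> b" "b \<noteq> c" "a \<noteq> c" "\<not> adj a b" "\<not> adj b c" "\<not> adj a c"
      and same: "adj a x = adj b x" for a b c
  proof -
    note T = types[OF A]
    obtain a' b' where p: "a' \<in> U" "adj a a'" "b' \<in> U" "adj b b'" using partner A T by metis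
    note one = one_nbr[OF no]
    have p': "adj a' a" "adj b' b" using p adj_sym by auto
    have ne: "a' \<noteq> b'" "a' \<noteq> b" "a' \<noteq> c" "b' \<noteq> a" "b' \<noteq> c"
      using one[of a' a b] p p' A adj_sym by blast+
    have na: "\<not> adj a' b" "\<not> adj a' c" "\<not> adj a b'" "\<not> adj b' c" "\<not> adj a' b'"
      using one[of a' a b] one[of a' a c] one[of b' b a] one[of b' b c] one[of a' a b'] p p' A ne adj_sym by blast+
    have "adj a' y" using types[of a' b c] p ne na A by blast
    moreover have "adj b' y" using types[of a b' c] p ne na A by blast
    ultimately have c1: "cherry a' y b'" using ne na adj_sym by (auto simp: cherry_def)
    have "\<exists>q\<in>{x, z}. adj a q \<and> adj b q" using T same by auto
    then obtain q where q: "q \<in> {x, z}" "adj a q" "adj b q" by blast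
    then have "cherry a q b" using A adj_sym by (auto simp: cherry_def)
    moreover have "a \<noteq> a'" "b \<noteq> b'" using p adj_irrefl by auto
    ultimately show False
      using cherries_meet[OF c1, of a q b] q ne A p U_V[OF A(1)] U_V[OF A(2)] U_V[OF p(1)] U_V[OF p(3)] base_V base_adj
      by auto
  qed
  have s: "\<not> adj b a" "\<not> adj c b" "\<not> adj c a" using abc adj_sym by blast+
  have "adj a x = adj b x \<or> adj b x = adj c x \<or> adj a x = adj c x" by blast
  then show False
    using key[of a b c] key[of b c a] key[of a c b] abc s by metis
qed

lemma small_matching:
  assumes no: "\<And>a b c. a \<in> U \<Longrightarrow> b \<in> U \<Longrightarrow> c \<in> U \<Longrightarrow> \<not> triangle a b c"
  shows "card (inner_edges V) \<le> 2 * card V"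
proof (rule ccontr)
  assume dense: "\<not> ?thesis"
  note one = one_nbr[OF no]
  have "2 * card (inner_edges U) = (\<Sum>u\<in>U. card (nbrs u U))" by (simp add: handshake)
  also have "\<dots> \<le> (\<Sum>u\<in>U. 1)" by (intro sum_mono matching[OF no])
  finally have half: "2 * card (inner_edges U) \<le> card U" by simp
  have le: "card (nbrs p U) \<le> card U" for p by (simp add: card_nbrs_le)
  have nonadj: "\<exists>w\<in>W. \<not> adj u w" if "u \<in> U" "W \<subseteq> U" "2 \<le> card W" for u W
  proof (rule ccontr)
    assume all: "\<not> ?thesis"
    then have "W \<subseteq> nbrs u U" using that by (auto simp: nbrs_def)
    then have "card W \<le> card (nbrs u U)" by (simp add: card_mono)
    then show False using matching[OF no that(1)] that(3) by simp
  qed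
  \<comment> \<open>There are at most \<open>3 * card U\<close> cross edges. With
    \<open>half\<close> this gives four vertices in \<open>U\<close>; from five on, a matching
    leaves an independent triple.\<close>
  have "4 < card (inner_edges U) + card U"
    using dense le[of x] le[of y] le[of z] unfolding card_inner_edges_V card_V by simp
  then have "4 \<le> card U" using half by presburger
  show False
  proof (cases "card U = 4")
    case False
    then have "5 \<le> card U" using \<open>4 \<le> card U\<close> by simp
    then obtain a where a: "a \<in> U" by (metis card.empty ex_in_conv not_numeral_le_zero)
    let ?W = "U - {a} - nbrs a U"
    have "card U - 1 - 1 \<le> card ?W"
      using matching[OF no a] a diff_card_le_card_Diff[of "nbrs a U" "U - {a}"] by simp
    then have W: "3 \<le> card ?W" using \<open>5 \<le> card U\<close> by linarith
    then obtain b where b: "b \<in> ?W" by (metis card.empty ex_in_conv not_numeral_le_zero)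
    have "2 \<le> card (?W - {b})" using W b by simp
    then obtain c where "c \<in> ?W - {b}" "\<not> adj b c" using nonadj[of b "?W - {b}"] b by blast
    then show False using independent_triple[OF no, of a b c] a b by (auto simp: nbrs_def)
  next
    case True
    \<comment> \<open>So at most one of the twelve cross pairs is not adjacent. Wherever it is, some
      vertex sees both x and z while two nonadjacent other vertices see y.\<close>
    have big: "11 \<le> card (nbrs x U) + card (nbrs y U) + card (nbrs z U)"
      using dense half True unfolding card_inner_edges_V card_V by simp
    have le4: "card (nbrs x U) \<le> 4" "card (nbrs y U) \<le> 4" "card (nbrs z U) \<le> 4" using le True by metis+
    have full: "adj u p" if "card (nbrs p U) = 4" "u \<in> U" for u p
    proof -
      have "nbrs p U = U" using that True by (intro card_subset_eq nbrs_subset) auto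
      then show ?thesis using that adj_sym by (auto simp: nbrs_def)
    qed
    have almost: "\<exists>q\<in>U. \<forall>u\<in>U - {q}. adj u p" if "3 \<le> card (nbrs p U)" for p
    proof -
      have "card (U - nbrs p U) \<le> 1" using that True by (simp add: card_Diff_subset nbrs_subset)
      then have "\<forall>u\<in>U - nbrs p U. \<forall>v\<in>U - nbrs p U. u = v" by (simp add: card_le_Suc0_iff_eq)
      moreover obtain u where "u \<in> U" using True by fastforce
      ultimately show ?thesis using adj_sym unfolding nbrs_def by blast
    qed
    consider (y) "card (nbrs y U) = 3" "card (nbrs x U) = 4" "card (nbrs z U) = 4"
      | (x) "card (nbrs y U) = 4" "3 \<le> card (nbrs x U)" "card (nbrs z U) = 4"
      | (z) "card (nbrs y U) = 4" "card (nbrs x U) = 4" "3 \<le> card (nbrs z U)"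
      using big le4 by linarith
    then show False
    proof cases
      case y
      obtain q where q: "q \<in> U" "\<forall>u\<in>U - {q}. adj u y" using almost[of y] y by auto
      have 3: "card (U - {q}) = 3" using q True by simp
      then obtain b where b: "b \<in> U - {q}" by (metis card.empty ex_in_conv zero_neq_numeral)
      then obtain c where "c \<in> U - {q} - {b}" "\<not> adj b c" using nonadj[of b "U - {q} - {b}"] 3 by auto
      then show False using not_centre_y[of q b c] q b full[of x q] full[of z q] y by auto
    next
      case x
      obtain q where q: "q \<in> U" "\<forall>u\<in>U - {q}. adj u x" using almost[of x] x by auto
      have 3: "card (U - {q}) = 3" using q True by simp
      then obtain c where c: "c \<in> U - {q}" "\<not> adj q c" using nonadj[of q "U - {q}"] q by auto
      then have "card (U - {q} - {c}) = 2" using 3 by simp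
      then obtain a where "a \<in> U - {q} - {c}" by (metis card.empty ex_in_conv zero_neq_numeral)
      then show False using not_centre_y[of a q c] q c full[of y q] full[of y c] full[of z a] x by auto
    next
      case z
      obtain q where q: "q \<in> U" "\<forall>u\<in>U - {q}. adj u z" using almost[of z] z by auto
      have 3: "card (U - {q}) = 3" using q True by simp
      then obtain c where c: "c \<in> U - {q}" "\<not> adj q c" using nonadj[of q "U - {q}"] q by auto
      then have "card (U - {q} - {c}) = 2" using 3 by simp
      then obtain a where "a \<in> U - {q} - {c}" by (metis card.empty ex_in_conv zero_neq_numeral)
      then show False using not_centre_y[of a q c] q c full[of y q] full[of y c] full[of x a] z by auto
    qed
  qed
qed

lemma sparse: "card (inner_edges V) \<le> 2 * card V"
proof (cases "\<exists>a\<in>U. \<exists>b\<in>U. \<exists>c\<in>U. triangle a b c")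
  case True
  then obtain a b c where abc: "triangle a b c" "a \<in> U" "b \<in> U" "c \<in> U" by blast
  then have "card {a, b, c} = 3" using adj_irrefl by (auto simp: triangle_def card_insert_if)
  then have "3 \<le> card U" using card_mono[of U "{a, b, c}"] abc by simp
  then show ?thesis using clique_case U_clique[OF abc] by blast
next
  case False
  then show ?thesis using small_matching by blast
qed

end

context adjacency
begin

text \<open>In a smallest counterexample all degrees are at least 3, and the vertices outside
  a cherry x, y, z induce a disjoint union of cliques.\<close>

theorem dense_disjoint_triples:
  assumes "finite V" "2 * card V < card (inner_edges V)"
  shows "disjoint_triples cherry V \<or> disjoint_triples triangle V"
  using assms
proof (induction "card V" arbitrary: V rule: less_induct)
  case less
  show ?case
  proof (cases "\<exists>v\<in>V. card (nbrs v V) \<le> 2")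
    case True
    then obtain v where v: "v \<in> V" "card (nbrs v V) \<le> 2" by blast
    let ?W = "V - {v}"
    have "nbrs v ?W = nbrs v V" using adj_irrefl by (auto simp: nbrs_def)
    then have "card (inner_edges V) = card (inner_edges ?W) + card (nbrs v V)"
      using card_inner_edges_insert[of ?W v] v less.prems by (simp add: insert_absorb)
    moreover have "card V = Suc (card ?W)" using v less.prems by (metis card_Suc_Diff1)
    ultimately have "disjoint_triples cherry ?W \<or> disjoint_triples triangle ?W"
      using less.prems v by (intro less.hyps) auto
    then show ?thesis using disjoint_triples_mono by blast
  next
    case False
    then have deg: "3 \<le> card (nbrs v V)" if "v \<in> V" for v using that by force
    show ?thesis
    proof (rule ccontr)
      assume none: "\<not> ?thesis"
      have noc: "\<not> cherry x y z" if "{x, y, z} \<subseteq> V" for x y z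
      proof
        assume "cherry x y z"
        then have "cherry_packing adj V x y z"
          by (intro cherry_packing.intro cherry_packing_axioms.intro adjacency_axioms less.prems(1) deg that)
            (use none in blast)+
        then show False using cherry_packing.sparse less.prems(2) by (metis not_le)
      qed
      \<comment> \<open>Without cherries every closed neighbourhood is a clique. A vertex of degree
        5 would give a clique on six vertices, and maximal degree 4 contradicts the density.\<close>
      have "card (nbrs v V) \<le> 4" if v: "v \<in> V" for v
      proof (rule ccontr)
        assume "\<not> card (nbrs v V) \<le> 4"
        then have "6 \<le> card (insert v (nbrs v V))"
          using less.prems adj_irrefl by (simp add: nbrs_def)
        moreover have "adj a b"
          if ab: "a \<in> insert v (nbrs v V)" "b \<in> insert v (nbrs v V)" "a \<noteq> b" for a b
        proof (rule ccontr)
          assume "\<not> adj a b"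
          then have "cherry a v b" using ab adj_sym by (auto simp: cherry_def nbrs_def)
          then show False using noc[of a v b] ab v by (auto simp: nbrs_def)
        qed
        moreover have "insert v (nbrs v V) \<subseteq> V" using v nbrs_subset by blast
        ultimately have "disjoint_triples triangle V" by (intro clique_disjoint_triangles)
        then show False using none by blast
      qed
      then have "(\<Sum>v\<in>V. card (nbrs v V)) \<le> (\<Sum>v\<in>V. 4)" by (rule sum_mono)
      then show False using handshake[of V] less.prems by simp
    qed
  qed
qed

end

subsection \<open>Equal edge numbers in small graphs\<close>

context adjacency
begin

text \<open>\<open>E j\<close> is the edge number of a \<open>k\<close>-subset of
  \<open>side vs j\<close> with the highest rank, for a ranking that may be chosen freely. The last
  property holds because \<open>side vs (j + 2)\<close> contains \<open>side vs j\<close> and has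
  only \<open>k + 1\<close> elements for the two smallest values of \<open>j\<close>.\<close>

lemma edge_zigzag:
  fixes rank :: "nat \<Rightarrow> nat"
  assumes "finite X" "0 < k" "2 * k \<le> card X"
    and rank: "inj_on rank {..k choose 2}"
    and none: "\<And>S T. S \<subseteq> X \<Longrightarrow> T \<subseteq> X \<Longrightarrow> S \<inter> T = {} \<Longrightarrow> card S = k \<Longrightarrow> card T = k
      \<Longrightarrow> card (inner_edges S) \<noteq> card (inner_edges T)"
  obtains E where "\<And>j. 2 * k - 1 \<le> j \<Longrightarrow> j \<le> card X \<Longrightarrow> E j \<le> k choose 2"
    "\<And>j. 2 * k - 1 \<le> j \<Longrightarrow> j < card X \<Longrightarrow> rank (E j) < rank (E (Suc j))"
    "\<And>j. j \<in> {2 * k - 1, 2 * k} \<Longrightarrow> j + 2 \<le> card X \<Longrightarrow> E (j + 2) \<le> E j + (k - 1) \<and> E j \<le> E (j + 2) + (k - 1)"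
proof -
  have le: "card (inner_edges S) \<le> k choose 2" if "S \<subseteq> X" "card S = k" for S
    using card_inner_edges_le[of S] that assms(1) finite_subset by blast
  define c where "c S = rank (card (inner_edges S))" for S
  have proper: "c S \<noteq> c T" if "S \<subseteq> X" "T \<subseteq> X" "S \<inter> T = {}" "card S = k" "card T = k" for S T
    using none[OF that] le that rank by (auto simp: c_def inj_on_def)
  show thesis
  proof (rule kneser_zigzag[of X k c])
    fix vs assume vs: "distinct vs" "set vs = X" "length vs = card X"
      and less: "\<And>j. 2 * k - 1 \<le> j \<Longrightarrow> j < card X \<Longrightarrow> max_colour k c (side vs j) < max_colour k c (side vs (Suc j))"
    have "\<exists>S. S \<subseteq> side vs j \<and> card S = k \<and> c S = max_colour k c (side vs j)" if "2 * k - 1 \<le> j" "j \<le> card X" for j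
    proof (rule max_colour_attained)
      show "k \<le> card (side vs j)" using that vs assms(2) by (simp add: card_side)
    qed simp
    then obtain S where S: "\<And>j. 2 * k - 1 \<le> j \<Longrightarrow> j \<le> card X \<Longrightarrow>
      S j \<subseteq> side vs j \<and> card (S j) = k \<and> c (S j) = max_colour k c (side vs j)" by metis
    show thesis
    proof (rule that[of "\<lambda>j. card (inner_edges (S j))"])
      fix j assume j: "2 * k - 1 \<le> j" "j \<le> card X"
      then have "S j \<subseteq> set vs" using S[OF j] side_subset[of j vs] vs(3) by auto
      then show "card (inner_edges (S j)) \<le> k choose 2" using le[of "S j"] S[OF j] vs(2) by simp
    next
      fix j assume j: "2 * k - 1 \<le> j" "j < card X"
      then show "rank (card (inner_edges (S j))) < rank (card (inner_edges (S (Suc j))))"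
        using less[OF j] S[of j] S[of "Suc j"] by (simp add: c_def)
    next
      fix j assume j: "j \<in> {2 * k - 1, 2 * k}" "j + 2 \<le> card X"
      have "card (side vs (j + 2)) = Suc k"
        using j assms(2) vs card_side[of vs "j + 2"] by auto
      moreover have "side vs j \<subseteq> side vs (j + 2)" by (auto simp: side_Suc_Suc)
      moreover have "2 * k - 1 \<le> j" "2 * k - 1 \<le> j + 2" using j by auto
      ultimately show "card (inner_edges (S (j + 2))) \<le> card (inner_edges (S j)) + (k - 1)
          \<and> card (inner_edges (S j)) \<le> card (inner_edges (S (j + 2))) + (k - 1)"
        using card_inner_edges_near[of "side vs (j + 2)" k "S j" "S (j + 2)"]
          card_inner_edges_near[of "side vs (j + 2)" k "S (j + 2)" "S j"] S[of j] S[of "j + 2"] j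
        by auto
    qed
  qed (use assms(1,2) proper in blast)+
qed

definition equal_edge_sets :: "nat \<Rightarrow> 'a set \<Rightarrow> bool" where
  "equal_edge_sets k X \<longleftrightarrow> (\<exists>S T. S \<subseteq> X \<and> T \<subseteq> X \<and> S \<inter> T = {} \<and> card S = k \<and> card T = k
     \<and> card (inner_edges S) = card (inner_edges T))"

text \<open>The colour order is chosen so that the first and the third edge number of the zig-zag are too far
  apart for two k-sets that share all but one element.\<close>

lemma equal_edge_sets_5:
  assumes "finite X" "card X = 18"
  shows "equal_edge_sets 5 X"
proof (rule ccontr)
  assume none: "\<not> ?thesis"
  \<comment> \<open>The order of the edge numbers is 0, 1, 10, 9, 2, ..., 8. The ten positions 9 to
    18 skip only one of the eleven ranks, so \<open>E 9\<close> is 0 or 1 and \<open>E 11\<close> is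
    10 or 9.\<close>
  define rank :: "nat \<Rightarrow> nat" where
    "rank n = (if n \<le> 1 then n else if n = 10 then 2 else if n = 9 then 3 else n + 2)" for n
  have "inj_on rank {..(5::nat) choose 2}"
    by (rule inj_onI) (auto simp: rank_def choose_two split: if_splits)
  then obtain E where E: "\<And>j. 9 \<le> j \<Longrightarrow> j \<le> 18 \<Longrightarrow> E j \<le> (5::nat) choose 2"
    "\<And>j. 9 \<le> j \<Longrightarrow> j < 18 \<Longrightarrow> rank (E j) < rank (E (Suc j))"
    "\<And>j. j \<in> {9, 10} \<Longrightarrow> j + 2 \<le> 18 \<Longrightarrow> E (j + 2) \<le> E j + 4 \<and> E j \<le> E (j + 2) + 4"
    using edge_zigzag[of X 5 rank] none assms unfolding equal_edge_sets_def by auto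
  have inc: "rank (E 9) < rank (E 10)" "rank (E 10) < rank (E 11)" "rank (E 11) < rank (E 12)"
    "rank (E 12) < rank (E 13)" "rank (E 13) < rank (E 14)" "rank (E 14) < rank (E 15)"
    "rank (E 15) < rank (E 16)" "rank (E 16) < rank (E 17)" "rank (E 17) < rank (E 18)"
    using E(2)[of 9] E(2)[of 10] E(2)[of 11] E(2)[of 12] E(2)[of 13] E(2)[of 14] E(2)[of 15] E(2)[of 16] E(2)[of 17]
    by simp_all
  have "E 18 \<le> 10" using E(1)[of 18] by (simp add: choose_two)
  then have "rank (E 18) \<le> 10" by (auto simp: rank_def)
  then have "rank (E 9) \<le> 1" "2 \<le> rank (E 11)" "rank (E 11) \<le> 3" using inc by linarith+
  then have "E 9 \<le> 1" "9 \<le> E 11" by (auto simp: rank_def split: if_splits)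
  then show False using E(3)[of 9] by simp
qed

lemma equal_edge_sets_4:
  assumes "finite X" "card X = 11"
  shows "equal_edge_sets 4 X"
proof (rule ccontr)
  assume none: "\<not> ?thesis"
  \<comment> \<open>The order of the edge numbers is 0, 1, 4, 6, 5, 2, 3, and five positions skip
    two ranks. Always \<open>E 9\<close> is 4, 5 or 6. If \<open>E 7\<close> is 0 or 1, then
    \<open>E 9\<close> is too far from it: the pair 1, 4 has consecutive ranks and leaves none for
    \<open>E 8\<close>. Otherwise \<open>E 7\<close> is 4, which forces \<open>E 8 = 6\<close> and
    \<open>E 10 = 2\<close>.\<close>
  define rank :: "nat \<Rightarrow> nat" where "rank n = [0, 1, 5, 6, 2, 4, 3] ! n" for n
  define unrank :: "nat \<Rightarrow> nat" where "unrank n = [0, 1, 4, 6, 5, 2, 3] ! n" for n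
  have small: "n = 0 \<or> n = 1 \<or> n = 2 \<or> n = 3 \<or> n = 4 \<or> n = 5 \<or> n = 6" if "n \<le> 6" for n :: nat
    using that by linarith
  have unrank: "unrank (rank n) = n \<and> rank n \<le> 6" if "n \<le> 6" for n
    using small[OF that] by (auto simp: rank_def unrank_def)
  have "inj_on rank {..(4::nat) choose 2}"
    by (rule inj_on_inverseI[where g = unrank]) (use unrank in \<open>simp add: choose_two\<close>)
  then obtain E where E: "\<And>j. 7 \<le> j \<Longrightarrow> j \<le> 11 \<Longrightarrow> E j \<le> (4::nat) choose 2"
    "\<And>j. 7 \<le> j \<Longrightarrow> j < 11 \<Longrightarrow> rank (E j) < rank (E (Suc j))"
    "\<And>j. j \<in> {7, 8} \<Longrightarrow> j + 2 \<le> 11 \<Longrightarrow> E (j + 2) \<le> E j + 3 \<and> E j \<le> E (j + 2) + 3"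
    using edge_zigzag[of X 4 rank] none assms unfolding equal_edge_sets_def by auto
  define r where "r j = rank (E j)" for j
  have r: "r 7 < r 8" "r 8 < r 9" "r 9 < r 10" "r 10 < r 11"
    using E(2)[of 7] E(2)[of 8] E(2)[of 9] E(2)[of 10] by (simp_all add: r_def)
  have E': "E j = unrank (r j) \<and> r j \<le> 6" if "7 \<le> j" "j \<le> 11" for j
    using E(1)[OF that] unrank[of "E j"] by (simp add: r_def choose_two)
  have near: "unrank (r 9) \<le> unrank (r 7) + 3" "unrank (r 7) \<le> unrank (r 9) + 3"
    "unrank (r 10) \<le> unrank (r 8) + 3" "unrank (r 8) \<le> unrank (r 10) + 3"
    using E(3)[of 7] E(3)[of 8] E'[of 7] E'[of 8] E'[of 9] E'[of 10] by simp_all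
  have r11: "r 11 \<le> 6" using E' by simp
  have "r 7 = 0 \<or> r 7 = 1 \<or> r 7 = 2" "r 8 = 1 \<or> r 8 = 2 \<or> r 8 = 3"
    "r 9 = 2 \<or> r 9 = 3 \<or> r 9 = 4" "r 10 = 3 \<or> r 10 = 4 \<or> r 10 = 5"
    using r r11 by linarith+
  then show False
    using near r by (elim disjE) (simp_all add: unrank_def)
qed

end

subsection \<open>Distances and homometric sets\<close>

text \<open>Multiplicity vectors inject these multisets into the lists counted by stars and
  bars.\<close>

lemma card_multisets_of_size:
  assumes "finite A"
  shows "card (multisets_of_size A n) \<le> (n + card A - 1) choose n"
proof -
  obtain xs where xs: "set xs = A" "distinct xs" using finite_distinct_list[OF assms] by blast
  have len: "length xs = card A" using xs distinct_card by fastforce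
  let ?f = "\<lambda>M. map (count M) xs"
  let ?L = "{l :: nat list. length l = card A \<and> sum_list l = n}"
  have "inj_on ?f (multisets_of_size A n)"
  proof (rule inj_onI)
    fix M N assume MN: "M \<in> multisets_of_size A n" "N \<in> multisets_of_size A n" "?f M = ?f N"
    show "M = N"
    proof (rule multiset_eqI)
      fix x show "count M x = count N x"
      proof (cases "x \<in> A")
        case True
        then show ?thesis using MN(3) xs by (auto simp: map_eq_conv)
      next
        case False
        then have "x \<notin># M" "x \<notin># N" using MN by (auto simp: multisets_of_size_def)
        then show ?thesis by (simp add: not_in_iff)
      qed
    qed
  qed
  moreover have "?f ` multisets_of_size A n \<subseteq> ?L"
  proof safe
    fix M assume "M \<in> multisets_of_size A n"
    then have M: "set_mset M \<subseteq> A" "size M = n" by (auto simp: multisets_of_size_def)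
    show "length (map (count M) xs) = card A" by (simp add: len)
    have "sum_list (map (count M) xs) = sum (count M) A"
      using xs by (metis sum_list_distinct_conv_sum_set)
    also have "\<dots> = sum (count M) (set_mset M)"
      using M assms by (intro sum.mono_neutral_right) (auto simp: not_in_iff)
    finally show "sum_list (map (count M) xs) = n" using M by (simp add: size_multiset_overloaded_eq)
  qed
  moreover have "finite ?L"
  proof (rule finite_subset)
    show "?L \<subseteq> {l. set l \<subseteq> {..n} \<and> length l = card A}"
      using member_le_sum_list by fastforce
  qed (simp add: finite_lists_length_eq)
  ultimately have "card (multisets_of_size A n) \<le> card ?L" by (rule card_inj_on_le)
  then show ?thesis by (simp add: card_length_sum_list)
qed

sublocale pair_graph \<subseteq> adj: adjacency "\<lambda>u v. (u, v) \<in> parcs G"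
proof
  show "(v, u) \<in> parcs G" if "(u, v) \<in> parcs G" for u v
    using that pair_sym_arcs by (auto simp: symmetric_def sym_def)
  show "(v, v) \<notin> parcs G" for v using pair_no_loops by fastforce
qed

context pair_graph
begin

lemma edge_set_eq: "edge_set G = adj.inner_edges (pverts G)"
  by (fastforce simp: edge_set_def adj.inner_edges_def image_iff dest: in_arcsD1 in_arcsD2)

text \<open>\<open>graph_dist\<close> as a natural number. The value is meaningful only if some walk
  joins the two vertices; \<open>graph_dist_eq\<close> obtains this from connectivity.\<close>

definition ndist :: "'a \<Rightarrow> 'a \<Rightarrow> nat" where
  "ndist u v = (LEAST l. \<exists>p. awalk u p v \<and> length p = l)"

lemma ndist_le: "awalk u p v \<Longrightarrow> ndist u v \<le> length p"
  unfolding ndist_def by (rule Least_le) blast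

end

locale connected_pair_graph = pair_graph +
  assumes conn: "Digraph_Component.connected (with_proj G)"
begin

lemma ex_awalk:
  assumes "u \<in> pverts G" "v \<in> pverts G"
  shows "\<exists>p. awalk u p v"
proof -
  have "strongly_connected (with_proj G)"
    using conn pair_sym_arcs by (intro symmetric_connected_imp_strongly_connected)
  then have "u \<rightarrow>\<^sup>*\<^bsub>with_proj G\<^esub> v" using assms by (auto simp: strongly_connected_def)
  then show ?thesis by (simp add: reachable_awalk)
qed

lemma ex_shortest:
  assumes "u \<in> pverts G" "v \<in> pverts G"
  shows "\<exists>p. awalk u p v \<and> length p = ndist u v"
  unfolding ndist_def by (rule LeastI_ex) (use ex_awalk[OF assms] in blast)

lemma graph_dist_eq:
  assumes "u \<in> pverts G" "v \<in> pverts G"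
  shows "graph_dist G u v = ereal (real (ndist u v))"
proof -
  obtain p where p: "awalk u p v" "length p = ndist u v" using ex_shortest[OF assms] by blast
  show ?thesis unfolding graph_dist_conv
  proof (rule INF_eqI)
    show "ereal (real (ndist u v)) \<le> ereal (real (length q))" if "q \<in> {p. awalk u p v}" for q
      using that ndist_le by simp
    show "y \<le> ereal (real (ndist u v))" if "\<And>q. q \<in> {p. awalk u p v} \<Longrightarrow> y \<le> ereal (real (length q))" for y
      using that[of p] p by simp
  qed
qed

lemma ndist_commute:
  assumes "u \<in> pverts G" "v \<in> pverts G"
  shows "ndist u v = ndist v u"
  using graph_dist_sym[of u v] assms by (simp add: graph_dist_eq)

lemma ndist_triangle:
  assumes "u \<in> pverts G" "v \<in> pverts G" "w \<in> pverts G"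
  shows "ndist u w \<le> ndist u v + ndist v w"
proof -
  obtain p q where "awalk u p v" "length p = ndist u v" "awalk v q w" "length q = ndist v w"
    using ex_shortest assms by metis
  then show ?thesis using ndist_le[of u "p @ q" w] by (auto intro: awalk_appendI)
qed

lemma ndist_self [simp]: "u \<in> pverts G \<Longrightarrow> ndist u u = 0"
  using ndist_le[of u "[]" u] by (simp add: awalk_Nil_iff)

lemma ndist_0: "u \<in> pverts G \<Longrightarrow> v \<in> pverts G \<Longrightarrow> ndist u v = 0 \<longleftrightarrow> u = v"
  using ex_shortest[of u v] by (auto simp: awalk_Nil_iff)

lemma ndist_1:
  assumes "u \<in> pverts G" "v \<in> pverts G"
  shows "ndist u v = 1 \<longleftrightarrow> (u, v) \<in> parcs G"
proof
  assume "ndist u v = 1"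
  then obtain p where p: "awalk u p v" "length p = 1" using ex_shortest[OF assms] by auto
  then obtain a where "p = [a]" by (auto simp: length_Suc_conv)
  then show "(u, v) \<in> parcs G" using p by (cases a) (auto simp: awalk_Cons_iff awalk_Nil_iff)
next
  assume a: "(u, v) \<in> parcs G"
  then have "awalk u [(u, v)] v" using assms by (simp add: awalk_Cons_iff awalk_Nil_iff)
  then have "ndist u v \<le> 1" using ndist_le[of u "[(u, v)]" v] by simp
  moreover have "u \<noteq> v" using a adj.adj_irrefl by blast
  ultimately show "ndist u v = 1" using ndist_0[OF assms] by linarith
qed

lemma ndist_step:
  assumes "u \<in> pverts G" "v \<in> pverts G" "ndist u v = Suc l"
  shows "\<exists>w\<in>pverts G. (u, w) \<in> parcs G \<and> ndist w v = l"
proof -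
  obtain p where p: "awalk u p v" "length p = Suc l" using ex_shortest[OF assms(1,2)] assms(3) by auto
  then obtain a q where q: "p = a # q" by (cases p) auto
  then have a: "a \<in> parcs G" "fst a = u" "awalk (snd a) q v" "length q = l"
    using p by (auto simp: awalk_Cons_iff)
  have uw: "(u, snd a) \<in> parcs G" using a by (cases a) auto
  then have w: "snd a \<in> pverts G" by (rule in_arcsD2)
  have "ndist (snd a) v \<le> l" using ndist_le[OF a(3)] a(4) by simp
  moreover have "Suc l \<le> 1 + ndist (snd a) v"
    using ndist_triangle[OF assms(1) w assms(2)] ndist_1[OF assms(1) w] uw assms(3) by simp
  ultimately show ?thesis using uw w by (intro bexI[of _ "snd a"]) auto
qed

text \<open>Along a shortest walk the distance to \<open>v\<close> drops by one at each step.
  Counting steps bounds the distance of two of its vertices from above, the triangle inequality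
  towards \<open>v\<close> from below.\<close>

lemma geodesic:
  assumes "u \<in> pverts G" "v \<in> pverts G" "ndist u v = l"
  obtains f where "\<And>i. i \<le> l \<Longrightarrow> f i \<in> pverts G" "\<And>i j. i \<le> j \<Longrightarrow> j \<le> l \<Longrightarrow> ndist (f i) (f j) = j - i"
proof -
  have "\<exists>f. \<forall>i\<le>l. f i \<in> pverts G \<and> ndist (f i) v = l - i \<and> (i < l \<longrightarrow> (f i, f (Suc i)) \<in> parcs G)
      \<and> f 0 = u"
    using assms(1,3)
  proof (induction l arbitrary: u)
    case 0
    then show ?case by (intro exI[of _ "\<lambda>_. u"]) simp
  next
    case (Suc l)
    obtain w where w: "w \<in> pverts G" "(u, w) \<in> parcs G" "ndist w v = l"
      using ndist_step[OF Suc.prems(1) assms(2) Suc.prems(2)] by blast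
    obtain f where f: "\<forall>i\<le>l. f i \<in> pverts G \<and> ndist (f i) v = l - i \<and> (i < l \<longrightarrow> (f i, f (Suc i)) \<in> parcs G)
      \<and> f 0 = w" using Suc.IH[OF w(1,3)] by blast
    show ?case
      by (rule exI[of _ "case_nat u f"]) (use f w Suc.prems in \<open>auto split: nat.splits\<close>)
  qed
  then obtain f where f: "\<And>i. i \<le> l \<Longrightarrow> f i \<in> pverts G" "\<And>i. i \<le> l \<Longrightarrow> ndist (f i) v = l - i"
    "\<And>i. i < l \<Longrightarrow> (f i, f (Suc i)) \<in> parcs G" by (metis less_imp_le)
  show thesis
  proof (rule that[OF f(1)])
    fix i j assume ij: "i \<le> j" "j \<le> l"
    have "ndist (f i) (f j) \<le> j - i"
      using ij
    proof (induction j)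
      case (Suc j)
      show ?case
      proof (cases "i = Suc j")
        case False
        then have "ndist (f i) (f j) \<le> j - i" using Suc by simp
        moreover have "ndist (f j) (f (Suc j)) = 1" using ndist_1[of "f j" "f (Suc j)"] f Suc by simp
        moreover have "ndist (f i) (f (Suc j)) \<le> ndist (f i) (f j) + ndist (f j) (f (Suc j))"
          using f(1) Suc.prems by (intro ndist_triangle) auto
        ultimately show ?thesis using False Suc.prems by linarith
      qed (use f(1) Suc.prems in simp)
    qed (use f(1) in simp)
    moreover have "ndist (f i) v \<le> ndist (f i) (f j) + ndist (f j) v"
      using f(1) ij assms(2) by (intro ndist_triangle) auto
    ultimately show "ndist (f i) (f j) = j - i" using f(2)[of i] f(2)[of j] ij by linarith
  qed
qed

lemma diameter:
  assumes "graph_diameter G = ereal (real d)"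
  shows "\<And>u v. u \<in> pverts G \<Longrightarrow> v \<in> pverts G \<Longrightarrow> ndist u v \<le> d"
    and "\<exists>u\<in>pverts G. \<exists>v\<in>pverts G. ndist u v = d"
proof -
  let ?V = "pverts G"
  have ne: "?V \<noteq> {}"
    using conn by (auto simp: connected_def strongly_connected_def)
  have sup: "(SUP p\<in>?V \<times> ?V. ereal (real (ndist (fst p) (snd p)))) = ereal (real d)"
    unfolding assms[symmetric] graph_diameter_def by (rule SUP_cong) (auto simp: graph_dist_eq)
  show "ndist u v \<le> d" if "u \<in> ?V" "v \<in> ?V" for u v
  proof -
    have "ereal (real (ndist (fst (u, v)) (snd (u, v)))) \<le> ereal (real d)"
      unfolding sup[symmetric] by (rule SUP_upper) (use that in simp)
    then show ?thesis by simp
  qed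
  have "(SUP p\<in>?V \<times> ?V. ereal (real (ndist (fst p) (snd p)))) \<in> (\<lambda>p. ereal (real (ndist (fst p) (snd p)))) ` (?V \<times> ?V)"
    using ne pair_finite_verts by (intro finite_Sup_in) (auto simp: sup_max max_def)
  then obtain p where p: "p \<in> ?V \<times> ?V" "ereal (real d) = ereal (real (ndist (fst p) (snd p)))"
    unfolding sup by blast
  then have "ndist (fst p) (snd p) = d" by simp
  then show "\<exists>u\<in>?V. \<exists>v\<in>?V. ndist u v = d" using p(1) by (metis mem_Times_iff)
qed

end

section \<open>Lower bounds for the homometric number\<close>

context pair_graph
begin

lemma le_homometric_number:
  assumes "homometric G S T" "S \<inter> T = {}" "card S = h" "card T = h"
  shows "h \<le> homometric_number G"
  unfolding homometric_number_def
proof (rule Max_ge)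
  show "finite {h. \<exists>S T. homometric G S T \<and> S \<inter> T = {} \<and> card S = h \<and> card T = h}"
  proof (rule finite_subset)
    show "{h. \<exists>S T. homometric G S T \<and> S \<inter> T = {} \<and> card S = h \<and> card T = h} \<subseteq> {..card (pverts G)}"
      using card_mono[OF pair_finite_verts] by (auto simp: homometric_def)
  qed simp
qed (use assms in blast)

lemma distance_mset_image:
  assumes "inj_on f I" "finite I"
  shows "distance_mset G (f ` I) = image_mset (\<lambda>P. pair_dist G (f ` P)) (mset_set {P. P \<subseteq> I \<and> card P = 2})"
proof -
  let ?Q = "{P. P \<subseteq> I \<and> card P = 2}"
  have "{P. P \<subseteq> f ` I \<and> card P = 2} = (`) f ` ?Q"
  proof (intro equalityI subsetI)
    fix P assume "P \<in> {P. P \<subseteq> f ` I \<and> card P = 2}"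
    then obtain R where "R \<subseteq> I" "P = f ` R" "card P = 2" by (auto simp: subset_image_iff)
    then show "P \<in> (`) f ` ?Q" using assms(1) by (auto simp: card_image inj_on_subset)
  qed (use assms(1) in \<open>auto simp: card_image inj_on_subset\<close>)
  moreover have "inj_on ((`) f) ?Q"
    using assms(1) by (auto intro!: inj_onI simp: inj_on_image_eq_iff)
  ultimately show ?thesis
    unfolding distance_mset_def by (simp add: image_mset_mset_set[symmetric] multiset.map_comp comp_def)
qed

lemma size_distance_mset: "finite S \<Longrightarrow> size (distance_mset G S) = card S choose 2"
  by (simp add: distance_mset_def n_subsets)

end

context connected_pair_graph
begin

lemma pair_dist_eq:
  "u \<in> pverts G \<Longrightarrow> v \<in> pverts G \<Longrightarrow> u \<noteq> v \<Longrightarrow> pair_dist G {u, v} = ereal (real (ndist u v))"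
  by (simp add: pair_dist_doubleton graph_dist_eq)

text \<open>A geodesic has \<open>d + 1\<close> vertices. Its first \<open>Suc d div 2\<close>
  vertices and the equally many that follow differ by a shift of the index, which preserves
  distances.\<close>

lemma half_diameter_le:
  assumes "u \<in> pverts G" "v \<in> pverts G" "ndist u v = d"
  shows "Suc d div 2 \<le> homometric_number G"
proof -
  let ?h = "Suc d div 2"
  obtain f where f: "\<And>i. i \<le> d \<Longrightarrow> f i \<in> pverts G" "\<And>i j. i \<le> j \<Longrightarrow> j \<le> d \<Longrightarrow> ndist (f i) (f j) = j - i"
    using geodesic[OF assms] by metis
  have inj: "i = j" if "i \<le> d" "j \<le> d" "f i = f j" for i j
    using f(2)[of i j] f(2)[of j i] f(1)[of i] f(1)[of j] that by (cases i j rule: linorder_cases) auto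
  define g where "g i = f (i + ?h)" for i
  have h: "i + ?h \<le> d" "i \<le> d" if "i < ?h" for i using that by linarith+
  have injf: "inj_on f {..<?h}" using inj h by (auto intro!: inj_onI)
  have injg: "inj_on g {..<?h}"
  proof (rule inj_onI)
    fix i j assume "i \<in> {..<?h}" "j \<in> {..<?h}" "g i = g j"
    then show "i = j" using inj[of "i + ?h" "j + ?h"] h[of i] h[of j] by (simp add: g_def)
  qed
  have "pair_dist G (f ` P) = pair_dist G (g ` P)" if "P \<in> {P. P \<subseteq> {..<?h} \<and> card P = 2}" for P
  proof -
    have "\<exists>i j. P = {i, j} \<and> i < j"
      using that by (auto simp: card_2_iff) (metis insert_commute linorder_neqE_nat)
    then obtain i j where ij: "P = {i, j}" "i < j" by blast
    then have j: "j < ?h" "i < ?h" using that by auto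
    have "f i \<noteq> f j" "g i \<noteq> g j" using inj_onD[OF injf, of i j] inj_onD[OF injg, of i j] j ij by auto
    moreover have "ndist (f i) (f j) = ndist (g i) (g j)"
      using f(2)[of i j] f(2)[of "i + ?h" "j + ?h"] ij h[OF j(1)] by (simp add: g_def)
    moreover have "f i \<in> pverts G" "f j \<in> pverts G" "g i \<in> pverts G" "g j \<in> pverts G"
      using f(1) h[OF j(1)] h[OF j(2)] by (auto simp: g_def)
    ultimately show ?thesis by (simp add: ij pair_dist_eq)
  qed
  then have "distance_mset G (f ` {..<?h}) = distance_mset G (g ` {..<?h})"
    unfolding distance_mset_image[OF injf finite_lessThan] distance_mset_image[OF injg finite_lessThan]
    by (intro image_mset_cong) simp
  moreover have "f ` {..<?h} \<subseteq> pverts G" "g ` {..<?h} \<subseteq> pverts G"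
    using f(1) h by (auto simp: g_def)
  moreover have "f ` {..<?h} \<inter> g ` {..<?h} = {}"
  proof -
    have "f i \<noteq> g j" if "i < ?h" "j < ?h" for i j
      using inj[of i "j + ?h"] h[OF that(1)] h[OF that(2)] that(1) by (auto simp: g_def)
    then show ?thesis by blast
  qed
  ultimately show ?thesis
    using injf injg by (intro le_homometric_number[of "f ` {..<?h}" "g ` {..<?h}"])
      (auto simp: homometric_def card_image)
qed

text \<open>Distances are taken in the whole graph, so nonadjacent vertices of \<open>S\<close> have
  distance exactly 2 and only the edge number is left to vary.\<close>

lemma distance_mset_near:
  assumes S: "S \<subseteq> pverts G" and near: "\<And>u v. u \<in> S \<Longrightarrow> v \<in> S \<Longrightarrow> ndist u v \<le> 2"
  shows "distance_mset G S = replicate_mset (card (adj.inner_edges S)) 1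
    + replicate_mset ((card S choose 2) - card (adj.inner_edges S)) 2"
proof -
  let ?Q = "{P. P \<subseteq> S \<and> card P = 2}"
  let ?E = "adj.inner_edges S"
  have finS: "finite S" using S pair_finite_verts by (rule finite_subset)
  then have finQ: "finite ?Q" by (auto intro: finite_subset[of _ "Pow S"])
  have sub: "?E \<subseteq> ?Q"
    using adj.adj_irrefl by (auto simp: adj.inner_edges_def card_insert_if)
  have val: "pair_dist G P = (if P \<in> ?E then 1 else 2)" if P: "P \<in> ?Q" for P
  proof -
    obtain u v where uv: "P = {u, v}" "u \<noteq> v" using P by (auto simp: card_2_iff)
    then have V: "u \<in> pverts G" "v \<in> pverts G" "u \<in> S" "v \<in> S" using P S by auto
    have "P \<in> ?E \<longleftrightarrow> (u, v) \<in> parcs G"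
      using V uv adj.adj_sym by (auto simp: adj.inner_edges_def doubleton_eq_iff)
    moreover have "ndist u v \<noteq> 0" "ndist u v \<le> 2" using ndist_0 near V uv by auto
    ultimately show ?thesis
      using pair_dist_eq[OF V(1,2) uv(2)] ndist_1[OF V(1,2)] uv by (cases "ndist u v = 1") auto
  qed
  have "mset_set ?Q = mset_set ?E + mset_set (?Q - ?E)"
    using mset_set_Union[of ?E "?Q - ?E"] sub finQ finite_subset[OF sub finQ] by (simp add: Un_absorb1)
  then have "distance_mset G S = image_mset (pair_dist G) (mset_set ?E) + image_mset (pair_dist G) (mset_set (?Q - ?E))"
    by (simp add: distance_mset_def)
  also have "image_mset (pair_dist G) (mset_set ?E) = image_mset (\<lambda>_. 1) (mset_set ?E)"
    using val sub finite_subset[OF sub finQ] by (intro image_mset_cong) auto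
  also have "image_mset (pair_dist G) (mset_set (?Q - ?E)) = image_mset (\<lambda>_. 2) (mset_set (?Q - ?E))"
    using val finQ by (intro image_mset_cong) auto
  finally show ?thesis
    using sub finQ finS by (simp add: image_mset_const_eq card_Diff_subset finite_subset n_subsets)
qed

lemma equal_edges_le_homometric_number:
  assumes "X \<subseteq> pverts G" "\<And>u v. u \<in> X \<Longrightarrow> v \<in> X \<Longrightarrow> ndist u v \<le> 2"
    and "adj.equal_edge_sets k X"
  shows "k \<le> homometric_number G"
proof -
  obtain S T where ST: "S \<subseteq> X" "T \<subseteq> X" "S \<inter> T = {}" "card S = k" "card T = k"
    "card (adj.inner_edges S) = card (adj.inner_edges T)"
    using assms(3) by (auto simp: adj.equal_edge_sets_def)
  then have "distance_mset G S = distance_mset G T"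
    using assms distance_mset_near[of S] distance_mset_near[of T] by (simp add: subset_iff)
  then show ?thesis
    using ST assms(1) by (intro le_homometric_number[of S T]) (auto simp: homometric_def)
qed

text \<open>The distance bound concerns \<open>X\<close> alone: the result serves for all vertices
  with \<open>D = d\<close> and for a closed neighbourhood with \<open>D = 2\<close>.\<close>

lemma bounded_distance_kneser:
  assumes X: "X \<subseteq> pverts G" and bound: "\<And>u v. u \<in> X \<Longrightarrow> v \<in> X \<Longrightarrow> ndist u v \<le> D"
    and "0 < D" and few: "((k choose 2) + D - 1 choose (D - 1)) + 2 * k < card X + 2"
  shows "k \<le> homometric_number G"
proof (cases "k = 0")
  case False
  let ?A = "(\<lambda>i. ereal (real i)) ` {1..D}"
  let ?N = "k choose 2"
  have finX: "finite X" using X pair_finite_verts by (rule finite_subset)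
  have img: "distance_mset G ` {S. S \<subseteq> X \<and> card S = k} \<subseteq> multisets_of_size ?A ?N"
  proof safe
    fix S assume S: "S \<subseteq> X" "k = card S"
    have finS: "finite S" using S finX finite_subset by blast
    have "pair_dist G P \<in> ?A" if P: "P \<subseteq> S" "card P = 2" for P
    proof -
      obtain u v where uv: "P = {u, v}" "u \<noteq> v" using P by (auto simp: card_2_iff)
      then have V: "u \<in> X" "v \<in> X" "u \<in> pverts G" "v \<in> pverts G" using P S X by auto
      then have "ndist u v \<in> {1..D}" using bound ndist_0[OF V(3,4)] uv by (simp add: Suc_leI)
      then show ?thesis using pair_dist_eq[OF V(3,4) uv(2)] uv by blast
    qed
    moreover have "finite {P. P \<subseteq> S \<and> card P = 2}" using finS by (auto intro: finite_subset[of _ "Pow S"])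
    ultimately have "set_mset (distance_mset G S) \<subseteq> ?A" by (auto simp: distance_mset_def)
    then show "distance_mset G S \<in> multisets_of_size ?A (card S choose 2)"
      using size_distance_mset[OF finS] by (simp add: multisets_of_size_def)
  qed
  have "card (distance_mset G ` {S. S \<subseteq> X \<and> card S = k}) \<le> card (multisets_of_size ?A ?N)"
    using img by (intro card_mono finite_multisets_of_size) auto
  also have "\<dots> \<le> (?N + card ?A - 1) choose ?N" by (rule card_multisets_of_size) simp
  also have "card ?A = D" by (subst card_image) (auto intro: inj_onI)
  also have "(?N + D - 1) choose ?N = (?N + D - 1) choose (D - 1)"
    using binomial_symmetric[of ?N "?N + D - 1"] \<open>0 < D\<close> by simp
  finally have le: "card (distance_mset G ` {S. S \<subseteq> X \<and> card S = k}) \<le> (?N + D - 1) choose (D - 1)" .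
  have "0 < (?N + D - 1) choose (D - 1)" using \<open>0 < D\<close> by simp
  then have "2 * k \<le> card X" using few by linarith
  then obtain S T where "S \<subseteq> X" "T \<subseteq> X" "S \<inter> T = {}" "card S = k" "card T = k"
    "distance_mset G S = distance_mset G T"
    using kneser[of X k "distance_mset G"] finX False le few by auto
  then show ?thesis
    using X by (intro le_homometric_number[of S T]) (auto simp: homometric_def)
qed simp

end

text \<open>Passing from \<open>m\<close> to \<open>m + 1\<close> multiplies the binomial by (n + m
  + 1) / (m + 1), which is at most n + 1.\<close>

lemma binomial_le_power: "(n + m) choose m \<le> (n + 1) ^ m"
proof (induction m)
  case (Suc m)
  have "Suc m * ((n + Suc m) choose Suc m) = (n + Suc m) * ((n + m) choose m)"
    using Suc_times_binomial[of m "n + m"] by simp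
  also have "\<dots> \<le> (Suc m * (n + 1)) * (n + 1) ^ m"
    using Suc by (intro mult_mono) auto
  finally have "Suc m * ((n + Suc m) choose Suc m) \<le> Suc m * (n + 1) ^ Suc m" by (simp only: power_Suc mult.assoc)
  then show ?case by (simp only: Suc_mult_le_cancel1)
qed simp

section \<open>The square-root bound and the arithmetic of the second claim\<close>

context connected_pair_graph
begin

lemma closed_neighbourhood:
  assumes "v \<in> pverts G"
  defines "X \<equiv> insert v (adj.nbrs v (pverts G))"
  shows "X \<subseteq> pverts G" "card X = Suc (card (adj.nbrs v (pverts G)))"
    and "\<And>u w. u \<in> X \<Longrightarrow> w \<in> X \<Longrightarrow> ndist u w \<le> 2"
proof -
  show sub: "X \<subseteq> pverts G" using assms by (auto simp: adj.nbrs_def)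
  show "card X = Suc (card (adj.nbrs v (pverts G)))"
    unfolding X_def using pair_finite_verts adj.adj_irrefl
    by (intro card_insert_disjoint) (auto simp: adj.nbrs_def)
  have one: "ndist u v \<le> 1" if "u \<in> X" for u
  proof (cases "u = v")
    case False
    then have "(u, v) \<in> parcs G" using that adj.adj_sym by (auto simp: X_def adj.nbrs_def)
    then show ?thesis using ndist_1[of u v] that sub assms(1) by auto
  qed (use assms(1) in simp)
  show "ndist u w \<le> 2" if "u \<in> X" "w \<in> X" for u w
    using ndist_triangle[of u v w] ndist_commute[of v w] one[OF that(1)] one[OF that(2)] that sub assms(1)
    by fastforce
qed

lemma disjoint_triples_le_homometric_number:
  assumes "adj.disjoint_triples R (pverts G)"
    and near: "\<And>x y z. R x y z \<Longrightarrow> (x, y) \<in> parcs G \<and> (y, z) \<in> parcs G \<and> x \<noteq> z"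
    and edges: "\<And>x y z. R x y z \<Longrightarrow> card (adj.inner_edges {x, y, z}) = c"
  shows "3 \<le> homometric_number G"
proof -
  obtain x y z x' y' z' where R: "R x y z" "R x' y' z'" "{x, y, z, x', y', z'} \<subseteq> pverts G"
    "{x, y, z} \<inter> {x', y', z'} = {}"
    using assms(1) by (auto simp: adj.disjoint_triples_def)
  have mset: "distance_mset G {x, y, z} = replicate_mset c 1 + replicate_mset (3 - c) 2 \<and> card {x, y, z} = 3"
    if R: "R x y z" and V: "{x, y, z} \<subseteq> pverts G" for x y z
  proof -
    have n: "(x, y) \<in> parcs G" "(y, z) \<in> parcs G" "x \<noteq> z" using near[OF R] by auto
    then have ne: "x \<noteq> y" "y \<noteq> z" using adj.adj_irrefl by auto
    then have card: "card {x, y, z} = 3" using n by simp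
    have sub: "{x, y, z} \<subseteq> insert y (adj.nbrs y (pverts G))"
      using n adj.adj_sym V by (auto simp: adj.nbrs_def)
    have "ndist u w \<le> 2" if "u \<in> {x, y, z}" "w \<in> {x, y, z}" for u w
      using closed_neighbourhood(3)[of y u w] sub that V by blast
    then show ?thesis
      using distance_mset_near[OF V] card edges[OF R] by (simp add: choose_two)
  qed
  have "card {x, y, z} = 3" "card {x', y', z'} = 3" "distance_mset G {x, y, z} = distance_mset G {x', y', z'}"
    using mset[OF R(1)] mset[OF R(2)] R(3) by auto
  then show ?thesis
    using R(3,4) by (intro le_homometric_number[of "{x, y, z}" "{x', y', z'}"]) (auto simp: homometric_def)
qed

lemma dense_three_le:
  assumes "2 * card (pverts G) < card (edge_set G)"
  shows "3 \<le> homometric_number G"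
proof -
  have tri: "card (adj.inner_edges {x, y, z}) = 2 + of_bool ((x, z) \<in> parcs G)"
    if "(x, y) \<in> parcs G" "(y, z) \<in> parcs G" "x \<noteq> z" for x y z
  proof -
    have "x \<noteq> y" "y \<noteq> z" using that adj.adj_irrefl by auto
    then show ?thesis using that by (simp add: adj.card_inner_edges_insert adj.card_nbrs_insert)
  qed
  consider "adj.disjoint_triples adj.cherry (pverts G)" | "adj.disjoint_triples adj.triangle (pverts G)"
    using adj.dense_disjoint_triples[OF pair_finite_verts] assms by (auto simp: edge_set_eq)
  then show ?thesis
  proof cases
    case 1
    then show ?thesis
      by (rule disjoint_triples_le_homometric_number[where c = 2]) (use tri in \<open>auto simp: adj.cherry_def\<close>)
  next
    case 2
    have "x \<noteq> z" if "(x, z) \<in> parcs G" for x z using that adj.adj_irrefl by blast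
    then show ?thesis
      using 2 by (intro disjoint_triples_le_homometric_number[where c = 3 and R = adj.triangle])
        (use tri in \<open>auto simp: adj.triangle_def\<close>)
  qed
qed

lemma edges_le_homometric_number:
  assumes "graph_diameter G = ereal (real d)" "2 \<le> d" "5 \<le> card (pverts G)"
  shows "2 * card (edge_set G) \<le> (homometric_number G)\<^sup>2 * card (pverts G)"
proof (rule ccontr)
  let ?V = "pverts G" and ?H = "homometric_number G"
  assume "\<not> ?thesis"
  then have dense: "?H\<^sup>2 * card ?V < 2 * card (edge_set G)" by simp
  \<comment> \<open>For diameter 2 and k = 2 the Kneser condition reads 2 + 4 < n + 2, which is
    where five vertices enter; from diameter 3 on a geodesic suffices.\<close>
  have two: "2 \<le> ?H"
  proof (cases "d = 2")
    case True
    then show ?thesis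
      using bounded_distance_kneser[of ?V d 2] diameter(1)[OF assms(1)] assms(3) by simp
  next
    case False
    obtain u v where "u \<in> ?V" "v \<in> ?V" "ndist u v = d" using diameter(2)[OF assms(1)] by blast
    then have "Suc d div 2 \<le> ?H" by (rule half_diameter_le)
    moreover have "2 \<le> Suc d div 2" using False assms(2) by linarith
    ultimately show ?thesis by simp
  qed
  have "\<exists>v\<in>?V. ?H\<^sup>2 < card (adj.nbrs v ?V)"
  proof (rule ccontr)
    assume "\<not> ?thesis"
    then have "(\<Sum>v\<in>?V. card (adj.nbrs v ?V)) \<le> (\<Sum>v\<in>?V. ?H\<^sup>2)" by (intro sum_mono) (auto simp: not_less)
    then show False
      using dense adj.handshake[OF pair_finite_verts] by (simp add: edge_set_eq mult.commute)
  qed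
  then obtain v where v: "v \<in> ?V" "?H\<^sup>2 < card (adj.nbrs v ?V)" by blast
  let ?X = "insert v (adj.nbrs v ?V)"
  note X = closed_neighbourhood[OF v(1)]
  have equal_edges: "k \<le> ?H" if k: "m \<le> card ?X" "\<And>Y. finite Y \<Longrightarrow> card Y = m \<Longrightarrow> adj.equal_edge_sets k Y" for k m
  proof -
    obtain Y where Y: "Y \<subseteq> ?X" "card Y = m" "finite Y"
      using obtain_subset_with_card_n[OF k(1)] by metis
    show ?thesis
    proof (rule equal_edges_le_homometric_number[of Y k])
      show "Y \<subseteq> ?V" using Y(1) X(1) by (rule subset_trans)
      show "ndist u w \<le> 2" if "u \<in> Y" "w \<in> Y" for u w using X(3)[of u w] that Y(1) by auto
      show "adj.equal_edge_sets k Y" using k(2) Y by simp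
    qed
  qed
  consider "?H = 2" | "?H = 3" | "?H = 4" | "5 \<le> ?H" using two by linarith
  then show False
  proof cases
    case 1
    then have "2 * card ?V < card (edge_set G)" using dense by simp
    then show False using dense_three_le 1 by simp
  next
    case 2
    then have "11 \<le> card ?X" using v X(2) by simp
    then show False using equal_edges[of 11 4] adj.equal_edge_sets_4 2 by simp
  next
    case 3
    then have "18 \<le> card ?X" using v X(2) by simp
    then show False using equal_edges[of 18 5] adj.equal_edge_sets_5 3 by simp
  next
    case 4
    let ?k = "Suc ?H"
    obtain h where h: "?H = h + 5" using 4 by (metis add.commute le_Suc_ex)
    have "2 * (?k choose 2) = (h + 6) * (h + 5)"
      by (simp add: h choose_two) (simp add: algebra_simps)
    moreover have "(h + 5) * (h + 5) < card (adj.nbrs v ?V)" using v by (simp add: h power2_eq_square)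
    ultimately have "(?k choose 2) + 1 + 2 * ?k < card ?X + 2"
      unfolding X(2) h by (simp add: algebra_simps)
    then show False using bounded_distance_kneser[OF X(1,3), of ?k] by simp
  qed
qed

text \<open>As k < x/2 + 1, the number binom(k,2) + 1 is at most 44/100 of the square of x, so the
  binomial is at most 44/100 of n. Moreover 2k < x + 2, and x is at most n / 2.2. The two fractions
  add up to less than 1.\<close>

lemma power_condition:
  assumes "2 \<le> d" "5 \<le> n" "d ^ (2 * d - 2) \<le> n"
  defines "x \<equiv> real n powr (1 / real (2 * d - 2))"
  defines "k \<equiv> nat \<lceil>x / 2\<rceil>"
  shows "((k choose 2) + d - 1 choose (d - 1)) + 2 * k < n + 2" "x / 2 \<le> real k"
proof -
  obtain m where m: "d = Suc (Suc m)" using assms(1) by (metis add_2_eq_Suc le_Suc_ex)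
  have n: "real n > 0" using assms(2) by simp
  have x_pow: "x ^ (2 * d - 2) = real n"
    using n assms(1) by (simp add: x_def powr_realpow[symmetric] powr_powr)
  then have x2_pow: "(x\<^sup>2) ^ (d - 1) = real n"
    by (simp add: power_mult[symmetric] right_diff_distrib')
  have x_pos: "0 < x" using n by (simp add: x_def)
  have x2: "5 \<le> x\<^sup>2"
  proof (cases "m = 0")
    case True
    then show ?thesis using x2_pow assms(2) m by simp
  next
    case False
    have "real d ^ (2 * d - 2) \<le> x ^ (2 * d - 2)" using assms(3) unfolding x_pow by (metis of_nat_le_iff of_nat_power)
    then have "real d \<le> x" using x_pos assms(1) by (subst (asm) power_mono_iff) auto
    then have "3 \<le> x" using False m by simp
    then have "3\<^sup>2 \<le> x\<^sup>2" by (intro power_mono) auto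
    then show ?thesis by simp
  qed
  \<comment> \<open>A rational just below the square root of 5. It bounds the linear and the
    constant term of \<open>N\<close> by multiples of the square of x: 1/8 + 1/8.8 + 1/5 is below
    44/100.\<close>
  have x22: "22 / 10 \<le> x"
  proof (rule ccontr)
    assume "\<not> ?thesis"
    then have "x\<^sup>2 \<le> (22 / 10)\<^sup>2" using x_pos by (intro power_mono) auto
    then show False using x2 by (simp add: power2_eq_square)
  qed
  have k: "x / 2 \<le> real k" "real k < x / 2 + 1"
    using x_pos by (simp_all add: k_def) linarith
  show "x / 2 \<le> real k" by (rule k(1))
  have "real (k choose 2) = real k * (real k - 1) / 2"
    by (simp add: binomial_gbinomial gbinomial_prod_rev numeral_2_eq_2 prod.atLeast0_lessThan_Suc)
  also have "\<dots> \<le> (x / 2 + 1) * (x / 2) / 2"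
    using k x_pos by (intro divide_right_mono mult_mono') auto
  also have "\<dots> = x\<^sup>2 / 8 + x / 4" by (simp add: power2_eq_square field_simps)
  finally have N: "real (k choose 2) + 1 \<le> x\<^sup>2 / 8 + x / 4 + 1" by simp
  have xx: "22 / 10 * x \<le> x\<^sup>2" using x22 x_pos by (simp add: power2_eq_square)
  then have N2: "real (k choose 2) + 1 \<le> 44 / 100 * x\<^sup>2" using N x2 by linarith
  have "real ((k choose 2) + d - 1 choose (d - 1)) \<le> (real (k choose 2) + 1) ^ (d - 1)"
  proof -
    have "real ((k choose 2) + (d - 1) choose (d - 1)) \<le> real (((k choose 2) + 1) ^ (d - 1))"
      by (simp only: of_nat_le_iff binomial_le_power)
    moreover have "(k choose 2) + d - 1 = (k choose 2) + (d - 1)" using assms(1) by simp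
    ultimately show ?thesis by (simp add: add.commute)
  qed
  also have "\<dots> \<le> (44 / 100 * x\<^sup>2) ^ (d - 1)" using N2 by (intro power_mono) auto
  also have "\<dots> = (44 / 100) ^ (d - 1) * real n" by (simp only: power_mult_distrib x2_pow)
  also have "\<dots> \<le> 44 / 100 * real n"
  proof -
    have "(44 / 100 :: real) ^ (d - 1) \<le> (44 / 100) ^ 1" using assms(1) by (intro power_decreasing) auto
    then show ?thesis using n by (intro mult_right_mono) auto
  qed
  finally have M: "real ((k choose 2) + d - 1 choose (d - 1)) \<le> 44 / 100 * real n" .
  have "x\<^sup>2 \<le> (x\<^sup>2) ^ (d - 1)" using x2 assms(1) by (intro self_le_power) auto
  then have "22 / 10 * x \<le> real n" using xx x2_pow by simp
  then have "real ((k choose 2) + d - 1 choose (d - 1)) + 2 * real k < real n + 2" using M k(2) n by linarith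
  then have "real (((k choose 2) + d - 1 choose (d - 1)) + 2 * k) < real (n + 2)" by simp
  then show "((k choose 2) + d - 1 choose (d - 1)) + 2 * k < n + 2" by (simp only: of_nat_less_iff)
qed

end

theorem theorem3:
  fixes G :: "'a pair_pre_digraph" and n e d :: nat
  assumes "pair_graph G"
    and "Digraph_Component.connected (with_proj G)"
    and "n = card (pverts G)"
    and "e = card (edge_set G)"
    and "graph_diameter G = ereal (real d)"
    and "n \<ge> 5"
    and "d \<ge> 2"
  shows "(\<forall>k::int. ((real_of_int k gchoose 2) + real d - 1) gchoose (d - 1)
                     < real n - 2 * real_of_int k + 2 \<longrightarrow>
            real (homometric_number G)
              \<ge> Max {real_of_int k, real d / 2, sqrt (2 * real e / real n)})
       \<and> (n \<ge> d ^ (2 * d - 2) \<longrightarrow>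
            real (homometric_number G)
              \<ge> Max {1 / 2 * real n powr (1 / real (2 * d - 2)), real d / 2,
                      sqrt (2 * real e / real n)})"
proof -
  interpret connected_pair_graph G
    using assms(1,2) by (simp add: connected_pair_graph_def connected_pair_graph_axioms_def)
  let ?H = "homometric_number G"
  obtain u v where "u \<in> pverts G" "v \<in> pverts G" "ndist u v = d" using diameter(2)[OF assms(5)] by blast
  then have "Suc d div 2 \<le> ?H" by (rule half_diameter_le)
  then have half: "real d / 2 \<le> real ?H" by linarith
  have "2 * e \<le> ?H\<^sup>2 * n"
    using edges_le_homometric_number[OF assms(5,7)] assms(3,4,6) by simp
  then have "real (2 * e) \<le> real (?H\<^sup>2 * n)" by (simp only: of_nat_le_iff)
  then have "2 * real e / real n \<le> (real ?H)\<^sup>2"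
    using assms(6) by (simp add: divide_le_eq)
  then have root: "sqrt (2 * real e / real n) \<le> real ?H" by (intro real_le_lsqrt) auto
  have kneser: "k \<le> ?H" if "((k choose 2) + d - 1 choose (d - 1)) + 2 * k < n + 2" for k
    using bounded_distance_kneser[of "pverts G" d k] diameter(1)[OF assms(5)] that assms(3,7) by simp
  show ?thesis
  proof (intro conjI allI impI)
    fix k :: int
    assume small: "((real_of_int k gchoose 2) + real d - 1) gchoose (d - 1) < real n - 2 * real_of_int k + 2"
    have "real_of_int k \<le> real ?H"
    \<comment> \<open>For k <= 0 the bound is trivial; for positive k the generalised binomials are
      ordinary ones.\<close>
    proof (cases "k \<le> 0")
      case False
      then obtain m where m: "k = int m" by (metis nonneg_int_cases linear)
      have "(real_of_int k gchoose 2) + real d - 1 = real ((m choose 2) + d - 1)"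
        using assms(7) by (simp add: m binomial_gbinomial of_nat_diff)
      then have "real ((m choose 2) + d - 1 choose (d - 1)) < real n - 2 * real m + 2"
        using small by (simp add: m binomial_gbinomial)
      then have "real (((m choose 2) + d - 1 choose (d - 1)) + 2 * m) < real (n + 2)" by simp
      then have "m \<le> ?H" by (intro kneser) (simp only: of_nat_less_iff)
      then show ?thesis by (simp add: m)
    qed simp
    then show "real ?H \<ge> Max {real_of_int k, real d / 2, sqrt (2 * real e / real n)}"
      using half root by simp
  next
    assume "n \<ge> d ^ (2 * d - 2)"
    note P = power_condition[OF assms(7,6) this]
    have "real n powr (1 / real (2 * d - 2)) / 2 \<le> real ?H"
      using P(2) kneser[OF P(1)] by linarith
    then show "real ?H \<ge> Max {1 / 2 * real n powr (1 / real (2 * d - 2)), real d / 2, sqrt (2 * real e / real n)}"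
      using half root by simp
  qed
qed

end
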